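(* Let $R$ be an $n$-Peirce ring defined by $n$ pairwise orthogonal $1$-Peirce idempotents $e_1,\dots,e_n$ with sum $1$ and a complete dyadic set of partitions $\{\lambda_0,\lambda_1,\dots,\lambda_r\}$ of $\{1,\dots,n\}$; that is, for each $i=0,\dots,r-1$, if $I$ is the exceptional element of $\lambda_i$, which is the union of two elements $J$ and $L$ of $\lambda_{i+1}$, then $e_J$ is a Peirce trivial idempotent of the ring $e_IRe_I$. (1) If $\{f_1,\dots,f_m\}$, with $m\le n$, is any set of pairwise orthogonal $1$-Peirce idempotents of $R$ with sum $1$, then $m=n$ and there are an invertible element $s\in R$ and a permutation $\sigma$ of $\{1,\dots,n\}$ such that $f_{\sigma(i)}=se_is^{-1}$ for all $i=1,\dots,n$. (2) Let $f=f^2\in R$ be a $k$-Peirce idempotent and let $f=\sum_{j=1}^k f_j$ be a representation of $f$ as a sum of $k$ pairwise orthogonal $1$-Peirce idempotents. Then for each $j$ there exist an index $i_j\in\{1,\dots,n\}$ and a $1$-Peirce idempotent $\epsilon_j\in e_{i_j}Re_{i_j}$ such that the left $R$-modules $Rf_j$ and $R\epsilon_j$ are isomorphic, where the idempotents $\epsilon_1,\dots,\epsilon_k$ can be chosen pairwise orthogonal. Consequently, $Rf$ is isomorphic to $R\epsilon$ as a left $R$-module, where $\epsilon=\sum_{j=1}^k\epsilon_j$. Moreover, if $f$ is a Peirce trivial idempotent of $R$, then $f$ is a $k$-Peirce idempotent for some $k\le n$, and in any representation $f=\sum_{j=1}^k f_j$ of $f$ as a sum of $k$ pairwise orthogonal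 $1$-Peirce idempotents one has $\epsilon_j=e_{i_j}$ for each $j$, and the correspondence $j\mapsto i_j$ is injective.
   Context: All rings are associative with identity and modules are unitary; for an idempotent $e$ of a ring $R$, $eRe$ is a ring with identity $e$. An idempotent $e\in R$ is inner Peirce trivial if $eR(1-e)Re=0$, outer Peirce trivial if $(1-e)ReR(1-e)=0$, and Peirce trivial if it is both. A ring is a $0$-Peirce ring if $1=0$; a ring $R$ is a $1$-Peirce ring if $1\ne0$ and $0,1$ are its only Peirce trivial idempotents; inductively, for $n>1$, $R$ is an $n$-Peirce ring if there are a Peirce trivial idempotent $e\in R$ and an integer $1\le m<n$ such that $eRe$ is an $m$-Peirce ring and $(1-e)R(1-e)$ is an $(n-m)$-Peirce ring. An idempotent $e\in R$ is an $n$-Peirce idempotent if $eRe$ is an $n$-Peirce ring. A partition of a finite nonempty set is a finite set of nonempty pairwise disjoint subsets whose union is the set. A partition $\lambda$ is a dyadic refinement of a partition $\gamma$ if all elements of $\gamma$, with one exception, are elements of $\lambda$, and the exceptional element of $\gamma$ is the union of two elements of $\lambda$. A set $\{\lambda_0,\lambda_1,\dots,\lambda_r\}$ of partitions of $S$ is a complete dyadic set of partitions if $\lambda_0=\{S\}$, $\lambda_{i+1}$ is a dyadic refinement of $\lambda_i$ for $i=0,\dots,r-1$, and all elements of $\lambda_r$ are one-element sets (so $r=|S|-1$). For $I\subseteq\{1,\dots,n\}$, $e_I=\sum_{i\in I}e_i$. *)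

theory Defs
  imports "HOL-Algebra.Ring" "HOL-Library.Disjoint_Sets" "HOL-Combinatorics.Permutations"
begin

definition idempotent_of :: "('a, 'm) ring_scheme \<Rightarrow> 'a \<Rightarrow> bool" where
  "idempotent_of R e \<longleftrightarrow> e \<in> carrier R \<and> e \<otimes>\<^bsub>R\<^esub> e = e"

definition corner :: "('a, 'm) ring_scheme \<Rightarrow> 'a \<Rightarrow> ('a, 'm) ring_scheme" where
  "corner R e =
     R\<lparr>carrier := {e \<otimes>\<^bsub>R\<^esub> x \<otimes>\<^bsub>R\<^esub> e | x. x \<in> carrier R}, one := e\<rparr>"

text \<open>A product of subsets of a ring, such as $eR(1-e)Re$, stands for the set of finite sums of
  products of elements; it is zero exactly when all these products are zero.\<close>

definition inner_peirce_trivial :: "('a, 'm) ring_scheme \<Rightarrow> 'a \<Rightarrow> bool" where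
  "inner_peirce_trivial R e \<longleftrightarrow> idempotent_of R e \<and>
     (\<forall>x\<in>carrier R. \<forall>y\<in>carrier R.
        e \<otimes>\<^bsub>R\<^esub> x \<otimes>\<^bsub>R\<^esub> (\<one>\<^bsub>R\<^esub> \<ominus>\<^bsub>R\<^esub> e) \<otimes>\<^bsub>R\<^esub> y \<otimes>\<^bsub>R\<^esub> e = \<zero>\<^bsub>R\<^esub>)"

definition outer_peirce_trivial :: "('a, 'm) ring_scheme \<Rightarrow> 'a \<Rightarrow> bool" where
  "outer_peirce_trivial R e \<longleftrightarrow> idempotent_of R e \<and>
     (\<forall>x\<in>carrier R. \<forall>y\<in>carrier R.
        (\<one>\<^bsub>R\<^esub> \<ominus>\<^bsub>R\<^esub> e) \<otimes>\<^bsub>R\<^esub> x \<otimes>\<^bsub>R\<^esub> e \<otimes>\<^bsub>R\<^esub> y \<otimes>\<^bsub>R\<^esub> (\<one>\<^bsub>R\<^esub> \<ominus>\<^bsub>R\<^esub> e) = \<zero>\<^bsub>R\<^esub>)"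

definition peirce_trivial :: "('a, 'm) ring_scheme \<Rightarrow> 'a \<Rightarrow> bool" where
  "peirce_trivial R e \<longleftrightarrow> inner_peirce_trivial R e \<and> outer_peirce_trivial R e"

inductive peirce_ring :: "nat \<Rightarrow> ('a, 'm) ring_scheme \<Rightarrow> bool" where
  zero: "\<lbrakk>ring R; \<one>\<^bsub>R\<^esub> = \<zero>\<^bsub>R\<^esub>\<rbrakk> \<Longrightarrow> peirce_ring 0 R"
| one: "\<lbrakk>ring R; \<one>\<^bsub>R\<^esub> \<noteq> \<zero>\<^bsub>R\<^esub>; {e. peirce_trivial R e} = {\<zero>\<^bsub>R\<^esub>, \<one>\<^bsub>R\<^esub>}\<rbrakk> \<Longrightarrow> peirce_ring 1 R"
| split: "\<lbrakk>ring R; 1 < n; peirce_trivial R e; 1 \<le> m; m < n;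
           peirce_ring m (corner R e);
           peirce_ring (n - m) (corner R (\<one>\<^bsub>R\<^esub> \<ominus>\<^bsub>R\<^esub> e))\<rbrakk> \<Longrightarrow> peirce_ring n R"

definition peirce_idempotent :: "nat \<Rightarrow> ('a, 'm) ring_scheme \<Rightarrow> 'a \<Rightarrow> bool" where
  "peirce_idempotent n R e \<longleftrightarrow> idempotent_of R e \<and> peirce_ring n (corner R e)"

text \<open>\<open>f 1, \<dots>, f k\<close> are pairwise orthogonal 1-Peirce idempotents of \<open>R\<close> with sum \<open>g\<close>.
  Since 1-Peirce idempotents are nonzero, orthogonality forces the \<open>f j\<close> to be distinct.
  For \<open>k = 0\<close> the sum is \<open>g = 0\<close>.\<close>

definition one_peirce_decomposition ::
    "('a, 'm) ring_scheme \<Rightarrow> nat \<Rightarrow> (nat \<Rightarrow> 'a) \<Rightarrow> 'a \<Rightarrow> bool" where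
  "one_peirce_decomposition R k f g \<longleftrightarrow>
     (\<forall>j\<in>{1..k}. peirce_idempotent 1 R (f j)) \<and>
     (\<forall>i\<in>{1..k}. \<forall>j\<in>{1..k}. i \<noteq> j \<longrightarrow> f i \<otimes>\<^bsub>R\<^esub> f j = \<zero>\<^bsub>R\<^esub>) \<and>
     finsum R f {1..k} = g"

text \<open>The partition \<open>P'\<close> is a dyadic refinement of the partition \<open>P\<close>, where \<open>I\<close> is the
  exceptional element of \<open>P\<close>, the union of the two elements \<open>J\<close>, \<open>L\<close> of \<open>P'\<close>.\<close>

definition dyadic_split ::
    "'i set set \<Rightarrow> 'i set set \<Rightarrow> 'i set \<Rightarrow> 'i set \<Rightarrow> 'i set \<Rightarrow> bool" where
  "dyadic_split P P' I J L \<longleftrightarrow>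
     I \<in> P \<and> I \<notin> P' \<and> P - {I} \<subseteq> P' \<and> J \<in> P' \<and> L \<in> P' \<and> J \<noteq> L \<and> I = J \<union> L"

definition dyadic_refinement :: "'i set set \<Rightarrow> 'i set set \<Rightarrow> bool" where
  "dyadic_refinement P' P \<longleftrightarrow> (\<exists>I J L. dyadic_split P P' I J L)"

definition complete_dyadic :: "'i set \<Rightarrow> nat \<Rightarrow> (nat \<Rightarrow> 'i set set) \<Rightarrow> bool" where
  "complete_dyadic S r lam \<longleftrightarrow>
     finite S \<and> S \<noteq> {} \<and>
     (\<forall>i\<le>r. partition_on S (lam i)) \<and>
     lam 0 = {S} \<and>
     (\<forall>i<r. dyadic_refinement (lam (Suc i)) (lam i)) \<and>
     (\<forall>X\<in>lam r. card X = 1)"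

definition left_principal :: "('a, 'm) ring_scheme \<Rightarrow> 'a \<Rightarrow> 'a set" where
  "left_principal R f = {x \<otimes>\<^bsub>R\<^esub> f | x. x \<in> carrier R}"

text \<open>Isomorphism of left ideals \<open>M\<close>, \<open>N\<close> of \<open>R\<close> as left \<open>R\<close>-modules. (The locale \<open>module\<close> of
  HOL-Algebra is restricted to commutative rings.)\<close>

definition left_module_iso :: "('a, 'm) ring_scheme \<Rightarrow> 'a set \<Rightarrow> 'a set \<Rightarrow> bool" where
  "left_module_iso R M N \<longleftrightarrow> (\<exists>h. bij_betw h M N \<and>
     (\<forall>x\<in>M. \<forall>y\<in>M. h (x \<oplus>\<^bsub>R\<^esub> y) = h x \<oplus>\<^bsub>R\<^esub> h y) \<and>
     (\<forall>r\<in>carrier R. \<forall>x\<in>M. h (r \<otimes>\<^bsub>R\<^esub> x) = r \<otimes>\<^bsub>R\<^esub> h x))"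

end

theory Submission
  imports Defs "HOL-Algebra.QuotRing"
begin

text \<open>
Refining $1$ along the given partitions produces a binary tree whose leaves are \<open>e 1, \<dots>, e n\<close> and in which the two
summands \<open>u\<close>, \<open>v\<close> at each node satisfy \<open>uRvRu = 0 = vRuRv\<close>. Two consequences carry everything.
Compression \<open>x \<mapsto> axa\<close> by a leaf \<open>a\<close> is multiplicative (\<open>peirce_tree_diagonal_mult\<close>), so \<open>R\<close> maps homomorphically onto
the product of the corners of the leaves. The kernel of this map is nilpotent, being assembled from off-diagonal blocks
of square zero; what is used of this is that an element with diagonal $1$ is a unit (\<open>peirce_tree_unit\<close>).
As a result, idempotents with equal diagonals are conjugate (\<open>peirce_tree_conjugate\<close>).

A one-Peirce idempotent is conjugate to its diagonal part, and the splittings along the tree cut that part into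
Peirce trivial pieces; only one piece survives. So it is conjugate to an idempotent below a single leaf
(\<open>one_peirce_unique_component\<close>), and orthogonal families give orthogonal compressions
(\<open>one_peirce_family_components\<close>). Left modules generated by conjugate idempotents are isomorphic, which yields the
statement on \<open>Rf\<close>.

If the family sums to $1$, every leaf is hit, so the family has at least \<open>n\<close> members. When it has exactly \<open>n\<close>, the
compressions are the leaves themselves and one unit conjugates the whole family. Applied to two trees of the same ring,
the same count shows that the number of leaves depends on the ring only (\<open>peirce_ring_unique\<close>). Finally, compressing a
Peirce trivial idempotent by a leaf gives a Peirce trivial idempotent of a one-Peirce ring, hence zero or the leaf.
Thus a Peirce trivial \<open>f\<close> is conjugate to a sum of leaves, their number is the only \<open>k\<close> for which \<open>f\<close> is
\<open>k\<close>-Peirce, and the count above forces the compressions to be exactly these leaves.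
\<close>


section \<open>Corner rings and Peirce trivial idempotents\<close>

lemma corner_simps [simp]:
  "x \<otimes>\<^bsub>corner R e\<^esub> y = x \<otimes>\<^bsub>R\<^esub> y"
  "x \<oplus>\<^bsub>corner R e\<^esub> y = x \<oplus>\<^bsub>R\<^esub> y"
  "\<zero>\<^bsub>corner R e\<^esub> = \<zero>\<^bsub>R\<^esub>"
  "\<one>\<^bsub>corner R e\<^esub> = e"
  by (simp_all add: corner_def)

text \<open>For orthogonal idempotents \<open>a\<close> and \<open>b\<close> this says that \<open>a\<close> is Peirce trivial in the corner of \<open>a + b\<close>.
Unlike Peirce triviality it is symmetric and speaks of \<open>R\<close> only, so no nested corners are needed.\<close>

definition peirce_separated :: "('a, 'm) ring_scheme \<Rightarrow> 'a \<Rightarrow> 'a \<Rightarrow> bool" where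
  "peirce_separated R a b \<longleftrightarrow> (\<forall>x\<in>carrier R. \<forall>y\<in>carrier R.
     a \<otimes>\<^bsub>R\<^esub> x \<otimes>\<^bsub>R\<^esub> b \<otimes>\<^bsub>R\<^esub> y \<otimes>\<^bsub>R\<^esub> a = \<zero>\<^bsub>R\<^esub> \<and>
     b \<otimes>\<^bsub>R\<^esub> x \<otimes>\<^bsub>R\<^esub> a \<otimes>\<^bsub>R\<^esub> y \<otimes>\<^bsub>R\<^esub> b = \<zero>\<^bsub>R\<^esub>)"

text \<open>The binary tree of splittings behind an $n$-Peirce ring, read from the leaves. It records the set \<open>A\<close>
of idempotents at the leaves together with their sum. Leaves form a set and not an indexed family:
orthogonal nonzero idempotents are distinct, and uniting sets requires no renumbering.\<close>

inductive peirce_tree :: "('a, 'm) ring_scheme \<Rightarrow> 'a set \<Rightarrow> 'a \<Rightarrow> bool" for R (structure) where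
  leaf: "peirce_idempotent 1 R a \<Longrightarrow> peirce_tree R {a} a"
| node: "\<lbrakk>peirce_tree R A a; peirce_tree R B b; a \<otimes> b = \<zero>; b \<otimes> a = \<zero>; peirce_separated R a b\<rbrakk>
    \<Longrightarrow> peirce_tree R (A \<union> B) (a \<oplus> b)"

lemma peirce_ring_imp_ring: "peirce_ring n R \<Longrightarrow> ring R"
  by (induction rule: peirce_ring.induct) auto

lemma peirce_ring_one_iff:
  "peirce_ring 1 R \<longleftrightarrow> ring R \<and> \<one>\<^bsub>R\<^esub> \<noteq> \<zero>\<^bsub>R\<^esub> \<and> {e. peirce_trivial R e} = {\<zero>\<^bsub>R\<^esub>, \<one>\<^bsub>R\<^esub>}"
  by (subst peirce_ring.simps) auto

context ring
begin

text \<open>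
Products are kept associated to the right; a relation \<open>u v = w\<close> is then also needed in the form that applies when
further factors follow.
\<close>

lemma mult_mult_eq:
  assumes "u \<otimes> v = w" "u \<in> carrier R" "v \<in> carrier R" "x \<in> carrier R"
  shows "u \<otimes> (v \<otimes> x) = w \<otimes> x"
  using assms by (metis m_assoc)

lemma idempotentD:
  assumes "idempotent_of R g"
  shows "g \<in> carrier R" "g \<otimes> g = g" "x \<in> carrier R \<Longrightarrow> g \<otimes> (g \<otimes> x) = g \<otimes> x"
  using assms by (auto simp: idempotent_of_def mult_mult_eq)

lemma in_corner_iff:
  assumes "idempotent_of R g"
  shows "x \<in> carrier (corner R g) \<longleftrightarrow> x \<in> carrier R \<and> g \<otimes> x = x \<and> x \<otimes> g = x"
proof
  note g = idempotentD[OF assms]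
  show "x \<in> carrier (corner R g) \<Longrightarrow> x \<in> carrier R \<and> g \<otimes> x = x \<and> x \<otimes> g = x"
    using g by (auto simp: corner_def m_assoc)
  show "x \<in> carrier R \<and> g \<otimes> x = x \<and> x \<otimes> g = x \<Longrightarrow> x \<in> carrier (corner R g)"
    unfolding corner_def by simp metis
qed

lemma ring_corner:
  assumes "idempotent_of R g"
  shows "ring (corner R g)"
proof -
  note g = idempotentD[OF assms] and c = in_corner_iff[OF assms]
  show ?thesis
  proof (rule ringI)
    show "abelian_group (corner R g)"
    proof (rule abelian_groupI)
      fix x assume "x \<in> carrier (corner R g)"
      then show "\<exists>y\<in>carrier (corner R g). y \<oplus>\<^bsub>corner R g\<^esub> x = \<zero>\<^bsub>corner R g\<^esub>"
        using g by (intro bexI[of _ "\<ominus> x"]) (auto simp: c l_minus r_minus l_neg)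
    qed (use g in \<open>auto simp: c l_distr r_distr a_ac\<close>)
    show "monoid (corner R g)"
      proof (rule monoidI)
      fix x y assume "x \<in> carrier (corner R g)" "y \<in> carrier (corner R g)"
      then show "x \<otimes>\<^bsub>corner R g\<^esub> y \<in> carrier (corner R g)"
        using g by (simp add: c) (metis m_assoc)
    qed (use g in \<open>auto simp: c m_assoc\<close>)
  qed (auto simp: c l_distr r_distr)
qed

lemma corner_minus:
  assumes "idempotent_of R g" "x \<in> carrier (corner R g)" "y \<in> carrier (corner R g)"
  shows "x \<ominus>\<^bsub>corner R g\<^esub> y = x \<ominus> y"
proof -
  note g = idempotentD[OF assms(1)] and c = in_corner_iff[OF assms(1)]
  interpret C: ring "corner R g" by (rule ring_corner[OF assms(1)])
  have "\<ominus>\<^bsub>corner R g\<^esub> y = \<ominus> y"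
    using assms(2,3) g by (intro C.minus_equality) (auto simp: c l_minus r_minus l_neg)
  then show ?thesis
    by (simp add: a_minus_def)
qed

lemma corner_corner:
  assumes "idempotent_of R g" "a \<in> carrier (corner R g)"
  shows "corner (corner R g) a = corner R a"
proof -
  note g = idempotentD[OF assms(1)] and c = in_corner_iff[OF assms(1)]
  have "{a \<otimes> x \<otimes> a | x. x \<in> carrier (corner R g)} = {a \<otimes> x \<otimes> a | x. x \<in> carrier R}" (is "?L = ?S")
  proof
    show "?L \<subseteq> ?S"
      by (auto simp: c)
    show "?S \<subseteq> ?L"
    proof
      fix y assume "y \<in> ?S"
      then obtain x where x: "x \<in> carrier R" "y = a \<otimes> x \<otimes> a"
        by blast
      have a: "a \<in> carrier R" "g \<otimes> a = a" "a \<otimes> g = a"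
        using assms(2) c by auto
      have "y = a \<otimes> (g \<otimes> x \<otimes> g) \<otimes> a"
        using a(1) g(1) x by (simp add: m_assoc a(2-3)[THEN mult_mult_eq] a(2))
      moreover have "g \<otimes> x \<otimes> g \<in> carrier (corner R g)"
        using g x by (auto simp: c m_assoc)
      ultimately show "y \<in> ?L"
        by blast
    qed
  qed
  then show ?thesis
    by (simp add: corner_def)
qed

lemma peirce_idempotent_corner_iff:
  assumes "idempotent_of R g" "a \<in> carrier (corner R g)"
  shows "peirce_idempotent k (corner R g) a \<longleftrightarrow> peirce_idempotent k R a"
  using assms in_corner_iff[OF assms(1)] corner_corner[OF assms]
  by (auto simp: peirce_idempotent_def idempotent_of_def)

lemma peirce_separated_corner_iff:
  assumes "idempotent_of R g" "a \<in> carrier (corner R g)" "b \<in> carrier (corner R g)"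
  shows "peirce_separated (corner R g) a b \<longleftrightarrow> peirce_separated R a b"
proof
  note g = idempotentD[OF assms(1)] and c = in_corner_iff[OF assms(1)]
  have a: "a \<in> carrier R" "g \<otimes> a = a" "a \<otimes> g = a"
    and b: "b \<in> carrier R" "g \<otimes> b = b" "b \<otimes> g = b"
    using assms c by auto
  show "peirce_separated R a b \<Longrightarrow> peirce_separated (corner R g) a b"
    by (auto simp: peirce_separated_def c)
  assume s: "peirce_separated (corner R g) a b"
  show "peirce_separated R a b"
    unfolding peirce_separated_def
  proof (intro ballI)
    fix x y assume xy: "x \<in> carrier R" "y \<in> carrier R"
    have "g \<otimes> x \<otimes> g \<in> carrier (corner R g)" "g \<otimes> y \<otimes> g \<in> carrier (corner R g)"
      using g xy by (auto simp: c m_assoc)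
    then have "a \<otimes> (g \<otimes> x \<otimes> g) \<otimes> b \<otimes> (g \<otimes> y \<otimes> g) \<otimes> a = \<zero> \<and>
        b \<otimes> (g \<otimes> x \<otimes> g) \<otimes> a \<otimes> (g \<otimes> y \<otimes> g) \<otimes> b = \<zero>"
      using s by (simp add: peirce_separated_def)
    then show "a \<otimes> x \<otimes> b \<otimes> y \<otimes> a = \<zero> \<and> b \<otimes> x \<otimes> a \<otimes> y \<otimes> b = \<zero>"
      using a(1) b(1) g(1) xy
      by (simp add: m_assoc a(2,3)[THEN mult_mult_eq] b(2,3)[THEN mult_mult_eq] a(2) b(2))
  qed
qed

lemma peirce_trivial_iff_separated:
  "peirce_trivial R e \<longleftrightarrow> idempotent_of R e \<and> peirce_separated R e (\<one> \<ominus> e)"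
  by (auto simp: peirce_trivial_def inner_peirce_trivial_def outer_peirce_trivial_def
      peirce_separated_def)

lemma idempotent_add:
  assumes "idempotent_of R a" "idempotent_of R b" "a \<otimes> b = \<zero>" "b \<otimes> a = \<zero>"
  shows "idempotent_of R (a \<oplus> b)" "a \<in> carrier (corner R (a \<oplus> b))" "b \<in> carrier (corner R (a \<oplus> b))"
proof -
  note ab = idempotentD[OF assms(1)] idempotentD[OF assms(2)] assms(3,4)
  show *: "idempotent_of R (a \<oplus> b)"
    using ab by (simp add: idempotent_of_def l_distr r_distr)
  show "a \<in> carrier (corner R (a \<oplus> b))" "b \<in> carrier (corner R (a \<oplus> b))"
    using ab by (simp_all add: in_corner_iff[OF *] l_distr r_distr)
qed

lemma minus_add_cancel:
  assumes "a \<in> carrier R" "b \<in> carrier R"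
  shows "(a \<oplus> b) \<ominus> a = b"
  using assms by (simp add: a_minus_def a_comm[of a b] a_assoc r_neg)

lemma idempotent_complement:
  assumes "idempotent_of R e"
  shows "idempotent_of R (\<one> \<ominus> e)" "e \<otimes> (\<one> \<ominus> e) = \<zero>" "(\<one> \<ominus> e) \<otimes> e = \<zero>" "e \<oplus> (\<one> \<ominus> e) = \<one>"
proof -
  have e: "e \<in> carrier R" "e \<otimes> e = e"
    using assms by (auto simp: idempotent_of_def)
  show "idempotent_of R (\<one> \<ominus> e)"
    using e by (auto simp: idempotent_of_def a_minus_def l_distr r_distr l_minus r_minus r_neg minus_minus)
  show "e \<otimes> (\<one> \<ominus> e) = \<zero>" "(\<one> \<ominus> e) \<otimes> e = \<zero>"
    using e by (simp_all add: a_minus_def l_distr r_distr l_minus r_minus r_neg)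
  show "e \<oplus> (\<one> \<ominus> e) = \<one>"
    using e by (simp add: a_minus_def a_lcomm[of e] r_neg)
qed

lemma peirce_trivial_corner_iff:
  assumes "idempotent_of R a" "idempotent_of R b" "a \<otimes> b = \<zero>" "b \<otimes> a = \<zero>"
  shows "peirce_trivial (corner R (a \<oplus> b)) a \<longleftrightarrow> peirce_separated R a b"
proof -
  let ?g = "a \<oplus> b"
  note g = idempotent_add[OF assms]
  interpret C: ring "corner R ?g" by (rule ring_corner[OF g(1)])
  have "?g \<in> carrier (corner R ?g)"
    using C.one_closed by simp
  then have "?g \<ominus>\<^bsub>corner R ?g\<^esub> a = b"
    using corner_minus[OF g(1)] g(2) minus_add_cancel idempotentD[OF assms(1)] idempotentD[OF assms(2)]
    by simp
  then show ?thesis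
    using C.peirce_trivial_iff_separated[of a] peirce_separated_corner_iff[OF g] g(2) assms(1)
    by (simp add: idempotent_of_def)
qed

end


section \<open>Transport along isomorphisms\<close>

lemma peirce_trivial_closed: "peirce_trivial R e \<Longrightarrow> e \<in> carrier R"
  by (simp add: peirce_trivial_def inner_peirce_trivial_def idempotent_of_def)

lemma ring_iso_hom_ring:
  assumes "ring R" "ring S" "h \<in> ring_iso R S"
  shows "ring_hom_ring R S h"
  using assms by (intro ring_hom_ringI2) (auto simp: ring_iso_def)

lemma ring_iso_idempotent:
  assumes "h \<in> ring_iso R S" "idempotent_of R e"
  shows "idempotent_of S (h e)"
  using assms by (metis idempotent_of_def ring_iso_memE(1,2))

lemma ring_iso_corner:
  fixes R (structure) and S (structure)
  assumes "ring R" "h \<in> ring_iso R S" "idempotent_of R e"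
  shows "h \<in> ring_iso (corner R e) (corner S (h e))"
proof (rule ring_iso_memI)
  interpret ring R by fact
  note h = ring_iso_memE[OF assms(2)] and e = idempotentD[OF assms(3)]
  have sub: "carrier (corner R e) \<subseteq> carrier R"
    by (auto simp: in_corner_iff[OF assms(3)])
  have surj: "h ` carrier R = carrier S"
    using h(5) by (rule bij_betw_imp_surj_on)
  have "h ` carrier (corner R e) = (\<lambda>x. h (e \<otimes> x \<otimes> e)) ` carrier R"
    by (auto simp: corner_def)
  also have "\<dots> = (\<lambda>x. h e \<otimes>\<^bsub>S\<^esub> h x \<otimes>\<^bsub>S\<^esub> h e) ` carrier R"
    using e h by (intro image_cong) auto
  also have "\<dots> = (\<lambda>y. h e \<otimes>\<^bsub>S\<^esub> y \<otimes>\<^bsub>S\<^esub> h e) ` (h ` carrier R)"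
    by (simp add: image_image)
  also have "\<dots> = carrier (corner S (h e))"
    by (auto simp: corner_def surj)
  finally have im: "h ` carrier (corner R e) = carrier (corner S (h e))" .
  show "bij_betw h (carrier (corner R e)) (carrier (corner S (h e)))"
    using inj_on_subset[OF bij_betw_imp_inj_on[OF h(5)] sub] im by (simp add: bij_betw_def)
  show "h x \<in> carrier (corner S (h e))" if "x \<in> carrier (corner R e)" for x
    using that im by blast
qed (use ring_iso_memE[OF assms(2)] ring.in_corner_iff[OF assms(1,3)] in auto)

lemma ring_iso_peirce_separated:
  assumes "ring R" "ring S" "h \<in> ring_iso R S" "a \<in> carrier R" "b \<in> carrier R"
  shows "peirce_separated S (h a) (h b) \<longleftrightarrow> peirce_separated R a b"
proof -
  interpret R: ring R by fact
  interpret H: ring_hom_ring R S h by (rule ring_iso_hom_ring) fact+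
  note h = ring_iso_memE[OF assms(3)]
  have surj: "carrier S = h ` carrier R"
    using h(5) by (simp add: bij_betw_def)
  have z: "h x = \<zero>\<^bsub>S\<^esub> \<longleftrightarrow> x = \<zero>\<^bsub>R\<^esub>" if "x \<in> carrier R" for x
    using h(5) that H.hom_zero R.zero_closed by (metis bij_betw_imp_inj_on inj_onD)
  have "h a \<otimes>\<^bsub>S\<^esub> h x \<otimes>\<^bsub>S\<^esub> h b \<otimes>\<^bsub>S\<^esub> h y \<otimes>\<^bsub>S\<^esub> h a = \<zero>\<^bsub>S\<^esub> \<longleftrightarrow>
      a \<otimes>\<^bsub>R\<^esub> x \<otimes>\<^bsub>R\<^esub> b \<otimes>\<^bsub>R\<^esub> y \<otimes>\<^bsub>R\<^esub> a = \<zero>\<^bsub>R\<^esub>"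
    if "x \<in> carrier R" "y \<in> carrier R" "a \<in> carrier R" "b \<in> carrier R" for x y a b
    using that h(1,2) z[of "a \<otimes>\<^bsub>R\<^esub> x \<otimes>\<^bsub>R\<^esub> b \<otimes>\<^bsub>R\<^esub> y \<otimes>\<^bsub>R\<^esub> a"] by simp
  then show ?thesis
    using assms(4,5) by (simp add: peirce_separated_def surj)
qed

lemma ring_iso_peirce_trivial:
  assumes "ring R" "ring S" "h \<in> ring_iso R S" "e \<in> carrier R"
  shows "peirce_trivial S (h e) \<longleftrightarrow> peirce_trivial R e"
proof -
  interpret R: ring R by fact
  interpret S: ring S by fact
  interpret H: ring_hom_ring R S h by (rule ring_iso_hom_ring) fact+
  note h = ring_iso_memE[OF assms(3)]
  have "idempotent_of S (h e) \<longleftrightarrow> idempotent_of R e"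
    using assms(4) h(1,2) h(5) unfolding idempotent_of_def
    by (metis R.m_closed bij_betw_imp_inj_on inj_onD)
  moreover have "h (\<one>\<^bsub>R\<^esub> \<ominus>\<^bsub>R\<^esub> e) = \<one>\<^bsub>S\<^esub> \<ominus>\<^bsub>S\<^esub> h e"
    using assms(4) h by (simp add: a_minus_def)
  ultimately show ?thesis
    using ring_iso_peirce_separated[OF assms(1-4), of "\<one>\<^bsub>R\<^esub> \<ominus>\<^bsub>R\<^esub> e"] assms(4)
    by (simp add: R.peirce_trivial_iff_separated S.peirce_trivial_iff_separated)
qed

text \<open>The induction passes to the two corners of the splitting, so it has to be over all targets and not only over
automorphisms of a fixed ring.\<close>

lemma peirce_ring_iso:
  fixes R :: "('a, 'm) ring_scheme" and S :: "('b, 'k) ring_scheme"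
  assumes "peirce_ring n R" "h \<in> ring_iso R S" "ring S"
  shows "peirce_ring n S"
  using assms
proof (induction arbitrary: S h rule: peirce_ring.induct)
  case (zero R)
  interpret H: ring_hom_ring R S h by (rule ring_iso_hom_ring) fact+
  have "\<one>\<^bsub>S\<^esub> = \<zero>\<^bsub>S\<^esub>"
    using zero.hyps(2) H.hom_one H.hom_zero by simp
  with zero show ?case
    by (intro peirce_ring.zero)
next
  case (one R)
  interpret R: ring R by fact
  interpret H: ring_hom_ring R S h by (rule ring_iso_hom_ring) fact+
  note h = ring_iso_memE[OF one.prems(1)]
  have surj: "carrier S = h ` carrier R" and inj: "inj_on h (carrier R)"
    using h(5) by (simp_all add: bij_betw_def)
  have "\<one>\<^bsub>S\<^esub> \<noteq> \<zero>\<^bsub>S\<^esub>"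
    using inj_onD[OF inj, of "\<one>\<^bsub>R\<^esub>" "\<zero>\<^bsub>R\<^esub>"] one.hyps(2) h(4) by auto
  moreover have "{e. peirce_trivial S e} = h ` {e. peirce_trivial R e}"
  proof (intro equalityI subsetI)
    fix x assume "x \<in> {e. peirce_trivial S e}"
    moreover from this obtain y where "y \<in> carrier R" "x = h y"
      using surj by (auto dest: peirce_trivial_closed)
    ultimately show "x \<in> h ` {e. peirce_trivial R e}"
      using ring_iso_peirce_trivial[OF one.hyps(1) one.prems(2,1)] by auto
  next
    fix x assume "x \<in> h ` {e. peirce_trivial R e}"
    then show "x \<in> {e. peirce_trivial S e}"
      using ring_iso_peirce_trivial[OF one.hyps(1) one.prems(2,1)]
      by (auto dest: peirce_trivial_closed)
  qed
  ultimately show ?case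
    using one h(4) by (intro peirce_ring.one) auto
next
  case (split R n e m)
  interpret R: ring R by fact
  interpret S: ring S by fact
  interpret H: ring_hom_ring R S h by (rule ring_iso_hom_ring) fact+
  note h = ring_iso_memE[OF split.prems(1)]
  have e: "idempotent_of R e"
    using split.hyps(3) by (simp add: R.peirce_trivial_iff_separated)
  then have e': "idempotent_of R (\<one>\<^bsub>R\<^esub> \<ominus>\<^bsub>R\<^esub> e)"
    by (rule R.idempotent_complement(1))
  have eq: "h (\<one>\<^bsub>R\<^esub> \<ominus>\<^bsub>R\<^esub> e) = \<one>\<^bsub>S\<^esub> \<ominus>\<^bsub>S\<^esub> h e"
    using e h by (simp add: a_minus_def idempotent_of_def)
  show ?case
  proof (rule peirce_ring.split)
    show "peirce_trivial S (h e)"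
      using ring_iso_peirce_trivial[OF split.hyps(1) split.prems(2,1)] split.hyps(3) e
      by (simp add: idempotent_of_def)
    show "peirce_ring m (corner S (h e))"
      by (intro split.IH(1)[OF ring_iso_corner[OF split.hyps(1) split.prems(1)]] S.ring_corner
          ring_iso_idempotent[OF split.prems(1)] e)
    show "peirce_ring (n - m) (corner S (\<one>\<^bsub>S\<^esub> \<ominus>\<^bsub>S\<^esub> h e))"
      unfolding eq[symmetric]
      by (intro split.IH(2)[OF ring_iso_corner[OF split.hyps(1) split.prems(1)]] S.ring_corner
          ring_iso_idempotent[OF split.prems(1)] e')
  qed (use split in auto)
qed

context ring
begin

lemma conjugation_ring_iso:
  assumes "s \<in> Units R"
  shows "(\<lambda>x. s \<otimes> x \<otimes> inv s) \<in> ring_iso R R"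
proof -
  have s: "s \<in> carrier R" "inv s \<in> carrier R" "inv s \<otimes> s = \<one>" "s \<otimes> inv s = \<one>"
    using assms by auto
  note s' = s(3,4)[THEN mult_mult_eq]
  have "bij_betw (\<lambda>x. s \<otimes> x \<otimes> inv s) (carrier R) (carrier R)"
    using s(1,2) by (intro bij_betwI[where g = "\<lambda>x. inv s \<otimes> x \<otimes> s"]) (auto simp: m_assoc s' s(3,4))
  then show ?thesis
    by (intro ring_iso_memI) (use s(1,2) in \<open>auto simp: m_assoc l_distr r_distr s' s(3,4)\<close>)
qed

lemma conjugate_eq:
  assumes "s \<in> Units R" "f \<in> carrier R" "e \<in> carrier R" "f \<otimes> s = s \<otimes> e"
  shows "f = s \<otimes> e \<otimes> inv s"
  using assms by (metis Units_closed Units_inv_closed Units_r_inv m_assoc r_one)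

lemma conjugate_sym:
  assumes "s \<in> Units R" "f \<in> carrier R" "e \<in> carrier R" "f \<otimes> s = s \<otimes> e"
  shows "e \<otimes> inv s = inv s \<otimes> f"
  using assms
  by (metis Units_closed Units_inv_closed Units_l_inv Units_r_inv l_one m_assoc m_closed r_one)

lemma conjugate_peirce_trivial:
  assumes "s \<in> Units R" "f \<in> carrier R" "e \<in> carrier R" "f \<otimes> s = s \<otimes> e"
  shows "peirce_trivial R f \<longleftrightarrow> peirce_trivial R e"
  using ring_iso_peirce_trivial[OF ring_axioms ring_axioms conjugation_ring_iso[OF assms(1)] assms(3)]
    conjugate_eq[OF assms] by simp

lemma conjugate_peirce_idempotent:
  assumes "s \<in> Units R" "f \<in> carrier R" "e \<in> carrier R" "f \<otimes> s = s \<otimes> e"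
    and "peirce_idempotent k R e"
  shows "peirce_idempotent k R f"
proof -
  have e: "idempotent_of R e" "peirce_ring k (corner R e)"
    using assms(5) by (auto simp: peirce_idempotent_def)
  have f: "idempotent_of R f"
    using ring_iso_idempotent[OF conjugation_ring_iso[OF assms(1)] e(1)] conjugate_eq[OF assms(1-4)] by simp
  then show ?thesis
    using peirce_ring_iso[OF e(2) ring_iso_corner[OF ring_axioms conjugation_ring_iso[OF assms(1)] e(1)]]
      conjugate_eq[OF assms(1-4)] ring_corner[OF f] by (simp add: peirce_idempotent_def)
qed

text \<open>Right multiplication by \<open>s\<close> is the isomorphism.\<close>

lemma conjugate_left_module_iso:
  assumes s: "s \<in> Units R" and f: "f \<in> carrier R" and e: "e \<in> carrier R" and eq: "f \<otimes> s = s \<otimes> e"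
  shows "left_module_iso R (left_principal R f) (left_principal R e)"
proof -
  have inv: "s \<in> carrier R" "inv s \<in> carrier R" "inv s \<otimes> s = \<one>" "s \<otimes> inv s = \<one>"
    using s by auto
  have sub: "left_principal R f \<subseteq> carrier R"
    using f by (auto simp: left_principal_def)
  have to: "x \<otimes> s \<in> left_principal R e" if x: "x \<in> left_principal R f" for x
  proof -
    obtain r where r: "r \<in> carrier R" "x = r \<otimes> f"
      using x by (auto simp: left_principal_def)
    then have "x \<otimes> s = (r \<otimes> s) \<otimes> e"
      using inv(1) f e eq by (simp add: m_assoc)
    then show ?thesis
      using r inv(1) by (auto simp: left_principal_def)
  qed
  have fro: "y \<otimes> inv s \<in> left_principal R f" if y: "y \<in> left_principal R e" for y
  proof -
    obtain r where r: "r \<in> carrier R" "y = r \<otimes> e"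
      using y by (auto simp: left_principal_def)
    then have "y \<otimes> inv s = (r \<otimes> inv s) \<otimes> f"
      using inv(2) f e conjugate_sym[OF assms] by (simp add: m_assoc)
    then show ?thesis
      using r inv(2) by (auto simp: left_principal_def)
  qed
  have "bij_betw (\<lambda>x. x \<otimes> s) (left_principal R f) (left_principal R e)"
    by (rule bij_betwI[where g = "\<lambda>y. y \<otimes> inv s"])
       (use to fro sub inv e in \<open>auto simp: m_assoc left_principal_def f\<close>)
  then show ?thesis
    unfolding left_module_iso_def using sub inv
    by (intro exI[of _ "\<lambda>x. x \<otimes> s"]) (auto simp: l_distr m_assoc subset_iff)
qed


section \<open>Trees of Peirce trivial splittings\<close>

lemma one_peirce_nonzero:
  assumes "peirce_idempotent 1 R a"
  shows "a \<noteq> \<zero>"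
  using assms unfolding peirce_idempotent_def peirce_ring_one_iff by simp

lemma peirce_tree_facts:
  assumes "peirce_tree R A a"
  shows "finite A" "A \<noteq> {}" "idempotent_of R a" "a \<noteq> \<zero>"
    and "\<And>x. x \<in> A \<Longrightarrow> peirce_idempotent 1 R x"
    and "\<And>x. x \<in> A \<Longrightarrow> x \<in> carrier (corner R a)"
    and "\<And>x y. x \<in> A \<Longrightarrow> y \<in> A \<Longrightarrow> x \<noteq> y \<Longrightarrow> x \<otimes> y = \<zero>"
    and "finsum R (\<lambda>x. x) A = a"
proof -
  have "finite A \<and> A \<noteq> {} \<and> idempotent_of R a \<and> a \<noteq> \<zero> \<and>
      (\<forall>x\<in>A. peirce_idempotent 1 R x \<and> x \<in> carrier (corner R a) \<and>
        (\<forall>y\<in>A. x \<noteq> y \<longrightarrow> x \<otimes> y = \<zero>)) \<and> finsum R (\<lambda>x. x) A = a"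
    using assms
  proof induction
    case (leaf a)
    then have "idempotent_of R a" "a \<noteq> \<zero>"
      using one_peirce_nonzero[OF leaf] by (auto simp: peirce_idempotent_def)
    with leaf show ?case
      using finsum_insert[of "{}" a "\<lambda>x. x"] by (auto simp: idempotent_of_def in_corner_iff)
  next
    case (node A a B b)
    have a: "idempotent_of R a" and b: "idempotent_of R b"
      using node.IH by auto
    note ab = idempotentD[OF a] idempotentD[OF b]
    note g = idempotent_add[OF a b node.hyps(3,4)]
    have xa: "x \<in> carrier R" "a \<otimes> x = x" "x \<otimes> a = x" if "x \<in> A" for x
      using node.IH(1) that in_corner_iff[OF a] by auto
    have xb: "x \<in> carrier R" "b \<otimes> x = x" "x \<otimes> b = x" if "x \<in> B" for x
      using node.IH(2) that in_corner_iff[OF b] by auto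
    have 1: "x \<otimes> y = \<zero>" "y \<otimes> x = \<zero>" if "x \<in> A" "y \<in> B" for x y
    proof -
      have "x \<otimes> y = x \<otimes> (a \<otimes> b) \<otimes> y"
        using xa[OF that(1)] xb[OF that(2)] ab by (metis m_assoc)
      then show "x \<otimes> y = \<zero>"
        using node.hyps(3) xa(1)[OF that(1)] xb(1)[OF that(2)] by simp
      have "y \<otimes> x = y \<otimes> (b \<otimes> a) \<otimes> x"
        using xa[OF that(1)] xb[OF that(2)] ab by (metis m_assoc)
      then show "y \<otimes> x = \<zero>"
        using node.hyps(4) xa(1)[OF that(1)] xb(1)[OF that(2)] by simp
    qed
    have 2: "x \<in> carrier (corner R (a \<oplus> b))" if "x \<in> A \<union> B" for x
    proof -
      have "b \<otimes> x = \<zero>" "x \<otimes> b = \<zero>" if "x \<in> A"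
        using xa[OF that] ab node.hyps(3,4) by (metis m_assoc l_null r_null)+
      moreover have "a \<otimes> x = \<zero>" "x \<otimes> a = \<zero>" if "x \<in> B"
        using xb[OF that] ab node.hyps(3,4) by (metis m_assoc l_null r_null)+
      ultimately show ?thesis
        using that xa xb ab by (auto simp: in_corner_iff[OF g(1)] l_distr r_distr)
    qed
    have disj: "A \<inter> B = {}"
    proof (rule ccontr)
      assume "A \<inter> B \<noteq> {}"
      then obtain x where x: "x \<in> A" "x \<in> B"
        by blast
      then have "x = x \<otimes> x"
        using node.IH(1) by (auto simp: peirce_idempotent_def idempotent_of_def)
      then have "x = \<zero>"
        using 1[OF x] by simp
      then show False
        using node.IH(1) x one_peirce_nonzero by blast
    qed
    have "finsum R (\<lambda>x. x) (A \<union> B) = a \<oplus> b"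
      using node.IH disj xa(1) xb(1) by (subst finsum_Un_disjoint) auto
    moreover have "a \<oplus> b \<noteq> \<zero>"
    proof
      assume "a \<oplus> b = \<zero>"
      then have "a \<otimes> (a \<oplus> b) = \<zero>"
        using ab by simp
      then show False
        using ab node.hyps(3) node.IH(1) by (simp add: r_distr)
    qed
    ultimately show ?case
      using node.IH g 1 2 by blast
  qed
  then show "finite A" "A \<noteq> {}" "idempotent_of R a" "a \<noteq> \<zero>"
    and "\<And>x. x \<in> A \<Longrightarrow> peirce_idempotent 1 R x"
    and "\<And>x. x \<in> A \<Longrightarrow> x \<in> carrier (corner R a)"
    and "\<And>x y. x \<in> A \<Longrightarrow> y \<in> A \<Longrightarrow> x \<noteq> y \<Longrightarrow> x \<otimes> y = \<zero>"
    and "finsum R (\<lambda>x. x) A = a"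
    by blast+
qed

lemma peirce_tree_absorb:
  assumes "peirce_tree R A a" "x \<in> A"
  shows "x \<in> carrier R" "a \<otimes> x = x" "x \<otimes> a = x" "x \<otimes> x = x"
  using peirce_tree_facts(6)[OF assms] peirce_tree_facts(5)[OF assms]
    in_corner_iff[OF peirce_tree_facts(3)[OF assms(1)]]
  by (auto simp: peirce_idempotent_def idempotent_of_def)

lemma peirce_tree_node_disjoint:
  assumes "peirce_tree R A a" "peirce_tree R B b" "a \<otimes> b = \<zero>"
  shows "A \<inter> B = {}"
proof (rule ccontr)
  assume "A \<inter> B \<noteq> {}"
  then obtain x where x: "x \<in> A" "x \<in> B"
    by blast
  note xa = peirce_tree_absorb[OF assms(1) x(1)] and xb = peirce_tree_absorb[OF assms(2) x(2)]
    and ab = idempotentD(1)[OF peirce_tree_facts(3)[OF assms(1)]] idempotentD(1)[OF peirce_tree_facts(3)[OF assms(2)]]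
  have "x \<otimes> x = x \<otimes> (a \<otimes> b) \<otimes> x"
    using xa xb ab by (metis m_assoc)
  then have "x = \<zero>"
    using xa assms(3) by simp
  then show False
    using one_peirce_nonzero peirce_tree_facts(5)[OF assms(1) x(1)] by blast
qed

text \<open>For \<open>g = 1\<close> this makes each compression \<open>x \<mapsto> axa\<close> multiplicative. At a node with sums \<open>u\<close> and \<open>v\<close> the
difference of \<open>x(u + v)y\<close> and \<open>xuy\<close>, seen between two factors below \<open>u\<close>, lies in \<open>uRvRu = 0\<close>.\<close>

lemma peirce_tree_diagonal_mult:
  assumes "peirce_tree R A g" "a \<in> A" "x \<in> carrier R" "y \<in> carrier R"
  shows "a \<otimes> x \<otimes> g \<otimes> y \<otimes> a = a \<otimes> x \<otimes> a \<otimes> y \<otimes> a"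
  using assms
proof induction
  case (leaf a)
  then show ?case by simp
next
  case (node A u B v)
  note t = node.hyps(1,2)
  have uv: "u \<in> carrier R" "v \<in> carrier R"
    using t[THEN peirce_tree_facts(3)] by (auto simp: idempotent_of_def)
  have sep: "u \<otimes> x \<otimes> v \<otimes> y \<otimes> u = \<zero>" "v \<otimes> x \<otimes> u \<otimes> y \<otimes> v = \<zero>"
    using node.hyps(5) node.prems by (auto simp: peirce_separated_def)
  show ?case
  proof (cases "a \<in> A")
    case True
    note a = peirce_tree_absorb[OF t(1) True]
    have "a \<otimes> x \<otimes> v \<otimes> y \<otimes> a = a \<otimes> (u \<otimes> x \<otimes> v \<otimes> y \<otimes> u) \<otimes> a"
      using a(1) uv node.prems by (simp add: m_assoc a(2,3) a(3)[THEN mult_mult_eq])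
    then have "a \<otimes> x \<otimes> v \<otimes> y \<otimes> a = \<zero>"
      using sep a(1) by simp
    then show ?thesis
      using node.IH(1)[OF True node.prems(2,3)] a(1) uv node.prems
      by (simp add: r_distr l_distr)
  next
    case False
    then have "a \<in> B"
      using node.prems by auto
    note a = peirce_tree_absorb[OF t(2) this]
    have "a \<otimes> x \<otimes> u \<otimes> y \<otimes> a = a \<otimes> (v \<otimes> x \<otimes> u \<otimes> y \<otimes> v) \<otimes> a"
      using a(1) uv node.prems by (simp add: m_assoc a(2,3) a(3)[THEN mult_mult_eq])
    then have "a \<otimes> x \<otimes> u \<otimes> y \<otimes> a = \<zero>"
      using sep a(1) by simp
    then show ?thesis
      using node.IH(2)[OF \<open>a \<in> B\<close> node.prems(2,3)] a(1) uv node.prems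
      by (simp add: r_distr l_distr)
  qed
qed


section \<open>Invertibility and conjugacy are decided on the diagonal\<close>

lemma finsum_sandwich:
  assumes "finite J" "f \<in> J \<rightarrow> carrier R" "x \<in> carrier R" "y \<in> carrier R"
  shows "x \<otimes> finsum R f J \<otimes> y = (\<Oplus>j\<in>J. x \<otimes> f j \<otimes> y)"
  using assms by (subst finsum_rdistr, simp_all) (subst finsum_ldistr, auto)

lemma finsum_absorb:
  assumes "finite J" "f \<in> J \<rightarrow> carrier R" "x \<in> carrier R" "j \<in> J" "x \<otimes> f j = w" "w \<in> carrier R"
    and "\<And>i. i \<in> J \<Longrightarrow> i \<noteq> j \<Longrightarrow> x \<otimes> f i = \<zero>"
  shows "x \<otimes> finsum R f J = w"
proof -
  have "x \<otimes> finsum R f J = (\<Oplus>i\<in>J. x \<otimes> f i)"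
    using assms by (simp add: finsum_rdistr)
  also have "\<dots> = (\<Oplus>i\<in>J. if j = i then w else \<zero>)"
    using assms by (intro finsum_cong') auto
  also have "\<dots> = w"
    using assms finsum_singleton[of j J "\<lambda>_. w"] by simp
  finally show ?thesis .
qed

lemma finsum_absorb_right:
  assumes "finite J" "f \<in> J \<rightarrow> carrier R" "x \<in> carrier R" "j \<in> J" "f j \<otimes> x = w" "w \<in> carrier R"
    and "\<And>i. i \<in> J \<Longrightarrow> i \<noteq> j \<Longrightarrow> f i \<otimes> x = \<zero>"
  shows "finsum R f J \<otimes> x = w"
proof -
  have "finsum R f J \<otimes> x = (\<Oplus>i\<in>J. f i \<otimes> x)"
    using assms by (simp add: finsum_ldistr)
  also have "\<dots> = (\<Oplus>i\<in>J. if j = i then w else \<zero>)"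
    using assms by (intro finsum_cong') auto
  also have "\<dots> = w"
    using assms finsum_singleton[of j J "\<lambda>_. w"] by simp
  finally show ?thesis .
qed

lemma orthogonal_sum_idempotent:
  assumes "finite J" "\<And>j. j \<in> J \<Longrightarrow> idempotent_of R (f j)"
    and "\<And>i j. i \<in> J \<Longrightarrow> j \<in> J \<Longrightarrow> i \<noteq> j \<Longrightarrow> f i \<otimes> f j = \<zero>"
  shows "idempotent_of R (finsum R f J)"
proof -
  have f: "f \<in> J \<rightarrow> carrier R"
    using assms(2) by (auto simp: idempotent_of_def)
  have "finsum R f J \<otimes> finsum R f J = (\<Oplus>j\<in>J. f j \<otimes> finsum R f J)"
    using assms(1) f by (intro finsum_ldistr) auto
  also have "\<dots> = finsum R f J"
  proof (intro finsum_cong' refl)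
    fix j assume j: "j \<in> J"
    show "f j \<otimes> finsum R f J = f j"
      by (rule finsum_absorb[OF assms(1) f _ j])
         (use j assms(2)[OF j] assms(3) in \<open>auto simp: idempotent_of_def\<close>)
  qed (use f in auto)
  finally show ?thesis
    using f by (simp add: idempotent_of_def)
qed

lemma square_zero_imp_unit:
  assumes "z \<in> carrier R" "z \<otimes> z = \<zero>"
  shows "\<one> \<oplus> z \<in> Units R"
proof -
  have "(\<one> \<oplus> z) \<otimes> (\<one> \<ominus> z) = \<one>" "(\<one> \<ominus> z) \<otimes> (\<one> \<oplus> z) = \<one>"
    using assms by (simp_all add: a_minus_def l_distr r_distr l_minus r_minus a_assoc r_neg l_neg)
  then show ?thesis
    using assms(1) by (auto simp: Units_def)
qed

lemma unit_of_two_sided_products: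
  assumes "x \<in> carrier R" "y \<in> carrier R" "x \<otimes> y \<in> Units R" "y \<otimes> x \<in> Units R"
  shows "x \<in> Units R"
proof -
  define p q where "p = inv (y \<otimes> x) \<otimes> y" and "q = y \<otimes> inv (x \<otimes> y)"
  have c: "p \<in> carrier R" "q \<in> carrier R"
    using assms by (auto simp: p_def q_def)
  have p: "p \<otimes> x = \<one>"
    using assms by (simp add: p_def m_assoc)
  have q: "x \<otimes> q = \<one>"
    using assms Units_r_inv[OF assms(3)] by (simp add: q_def m_assoc[symmetric])
  have "p = q"
    using p q c assms(1) by (metis l_one m_assoc r_one)
  then show ?thesis
    using p q c assms(1) by (auto simp: Units_def)
qed

text \<open>The off-diagonal part of a two-by-two Peirce decomposition is an ideal of square zero: \<open>pq\<close> and \<open>qp\<close> vanish by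
separation, \<open>pp\<close> and \<open>qq\<close> by orthogonality.\<close>

lemma separated_off_diagonal_square_zero:
  assumes "peirce_separated R u v" "u \<otimes> v = \<zero>" "v \<otimes> u = \<zero>" "u \<in> carrier R" "v \<in> carrier R"
    and p: "p \<in> carrier R" "u \<otimes> p = p" "p \<otimes> v = p"
    and q: "q \<in> carrier R" "v \<otimes> q = q" "q \<otimes> u = q"
  shows "(p \<oplus> q) \<otimes> (p \<oplus> q) = \<zero>"
proof -
  have "p \<otimes> q = u \<otimes> p \<otimes> v \<otimes> q \<otimes> u" "q \<otimes> p = v \<otimes> q \<otimes> u \<otimes> p \<otimes> v"
    using p q assms(4,5) by (simp_all add: m_assoc)
  then have "p \<otimes> q = \<zero>" "q \<otimes> p = \<zero>"
    using assms(1) p(1) q(1) unfolding peirce_separated_def by metis+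
  moreover have "p \<otimes> p = p \<otimes> (v \<otimes> u) \<otimes> p" "q \<otimes> q = q \<otimes> (u \<otimes> v) \<otimes> q"
    using p q assms(4,5) by (simp_all add: m_assoc p(3)[THEN mult_mult_eq] q(3)[THEN mult_mult_eq])
  then have "p \<otimes> p = \<zero>" "q \<otimes> q = \<zero>"
    using assms(2,3) p q by simp_all
  ultimately show ?thesis
    using p q by (simp add: l_distr r_distr)
qed

text \<open>Multiplying \<open>x\<close> on either side by the block diagonal inverse \<open>y + w\<close> gives \<open>1\<close> plus an off-diagonal element,
which is a unit because off-diagonal elements have square zero.\<close>

lemma separated_block_unit:
  assumes "peirce_separated R u v" "idempotent_of R u" "idempotent_of R v" "u \<otimes> v = \<zero>" "v \<otimes> u = \<zero>"
    and sum: "u \<oplus> v = \<one>" and x: "x \<in> carrier R"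
    and y: "y \<in> carrier (corner R u)" "u \<otimes> x \<otimes> y = u" "y \<otimes> x \<otimes> u = u"
    and w: "w \<in> carrier (corner R v)" "v \<otimes> x \<otimes> w = v" "w \<otimes> x \<otimes> v = v"
  shows "x \<in> Units R"
proof -
  have u: "u \<in> carrier R" "u \<otimes> u = u" and v: "v \<in> carrier R" "v \<otimes> v = v"
    using assms(2,3) by (auto simp: idempotent_of_def)
  have y': "y \<in> carrier R" "u \<otimes> y = y" "y \<otimes> u = y" and w': "w \<in> carrier R" "v \<otimes> w = w" "w \<otimes> v = w"
    using y(1) w(1) assms(2,3) by (auto simp: in_corner_iff)
  define p q where "p = u \<otimes> x \<otimes> w" and "q = v \<otimes> x \<otimes> y"
  define p' q' where "p' = y \<otimes> x \<otimes> v" and "q' = w \<otimes> x \<otimes> u"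
  have c: "p \<in> carrier R" "q \<in> carrier R" "p' \<in> carrier R" "q' \<in> carrier R"
    using u v x y' w' by (auto simp: p_def q_def p'_def q'_def)
  have "(p \<oplus> q) \<otimes> (p \<oplus> q) = \<zero>"
    by (rule separated_off_diagonal_square_zero[OF assms(1,4,5) u(1) v(1)])
       (use c x in \<open>simp_all add: p_def q_def m_assoc y' w' u v u(2)[THEN mult_mult_eq] v(2)[THEN mult_mult_eq]\<close>)
  moreover have "x \<otimes> (y \<oplus> w) = \<one> \<oplus> (p \<oplus> q)"
  proof -
    have "x \<otimes> (y \<oplus> w) = (u \<oplus> v) \<otimes> x \<otimes> (y \<oplus> w)"
      using sum x y' w' by simp
    also have "\<dots> = (u \<otimes> x \<otimes> y \<oplus> v \<otimes> x \<otimes> w) \<oplus> (p \<oplus> q)"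
      using u(1) v(1) x y'(1) w'(1) by (simp add: l_distr r_distr a_ac p_def q_def)
    finally show ?thesis
      using y w sum by simp
  qed
  moreover have "(p' \<oplus> q') \<otimes> (p' \<oplus> q') = \<zero>"
    by (rule separated_off_diagonal_square_zero[OF assms(1,4,5) u(1) v(1)])
       (use c x in \<open>simp_all add: p'_def q'_def m_assoc y' w' u v y'(2)[THEN mult_mult_eq] w'(2)[THEN mult_mult_eq]\<close>)
  moreover have "(y \<oplus> w) \<otimes> x = \<one> \<oplus> (p' \<oplus> q')"
  proof -
    have "(y \<oplus> w) \<otimes> x = (y \<oplus> w) \<otimes> x \<otimes> (u \<oplus> v)"
      using sum x y' w' by simp
    also have "\<dots> = (y \<otimes> x \<otimes> u \<oplus> w \<otimes> x \<otimes> v) \<oplus> (p' \<oplus> q')"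
      using u(1) v(1) x y'(1) w'(1) by (simp add: l_distr r_distr a_ac p'_def q'_def)
    finally show ?thesis
      using y w sum by simp
  qed
  ultimately show ?thesis
    using square_zero_imp_unit[of "p \<oplus> q"] square_zero_imp_unit[of "p' \<oplus> q'"] c x y' w'
    by (intro unit_of_two_sided_products[of x "y \<oplus> w"]) auto
qed

text \<open>This replaces the statement that the kernel of the diagonal map is nilpotent: descending the tree, an element
with identity diagonal is inverted one two-by-two block at a time.\<close>

lemma peirce_tree_unit_corner:
  assumes "peirce_tree R A g" "x \<in> carrier (corner R g)" "\<And>a. a \<in> A \<Longrightarrow> a \<otimes> x \<otimes> a = a"
  shows "x \<in> Units (corner R g)"
  using assms
proof (induction arbitrary: x)
  case (leaf a)
  have "idempotent_of R a"
    using leaf.hyps by (simp add: peirce_idempotent_def)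
  then have "x = a"
    using leaf.prems by (auto simp: in_corner_iff)
  then show ?case
    using leaf.prems(1) \<open>idempotent_of R a\<close> by (auto simp: Units_def idempotent_of_def intro!: bexI[of _ a])
next
  case (node A u B v)
  let ?C = "corner R (u \<oplus> v)"
  note t = node.hyps(1,2)
  have i: "idempotent_of R u" "idempotent_of R v"
    using t by (auto dest: peirce_tree_facts(3))
  note uv = idempotentD(1,2)[OF i(1)] idempotentD(1,2)[OF i(2)]
  note g = idempotent_add[OF i node.hyps(3,4)]
  have x: "x \<in> carrier R"
    using node.prems(1) by (simp add: in_corner_iff[OF g(1)])
  interpret C: ring ?C by (rule ring_corner[OF g(1)])
  \<comment> \<open>The induction hypothesis inverts the block \<open>axa\<close>; as the inverse lies in the corner of \<open>a\<close>, one factor \<open>a\<close> is redundant.\<close>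
  have block: "\<exists>y\<in>carrier (corner R a). a \<otimes> x \<otimes> y = a \<and> y \<otimes> x \<otimes> a = a"
    if "peirce_tree R A' a" "A' \<subseteq> A \<union> B"
      "\<And>x. x \<in> carrier (corner R a) \<Longrightarrow> (\<And>b. b \<in> A' \<Longrightarrow> b \<otimes> x \<otimes> b = b) \<Longrightarrow> x \<in> Units (corner R a)"
    for A' a
  proof -
    have a: "idempotent_of R a"
      using that(1) by (rule peirce_tree_facts(3))
    note a' = idempotentD[OF a]
    have "a \<otimes> x \<otimes> a \<in> carrier (corner R a)"
      using a' x by (simp add: in_corner_iff[OF a] m_assoc)
    moreover have "b \<otimes> (a \<otimes> x \<otimes> a) \<otimes> b = b" if b: "b \<in> A'" for b
    proof -
      note b' = peirce_tree_absorb[OF \<open>peirce_tree R A' a\<close> b]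
      have "b \<otimes> (a \<otimes> x \<otimes> a) \<otimes> b = b \<otimes> x \<otimes> b"
        using a'(1) x b'(1) by (simp add: m_assoc b'(2) b'(3)[THEN mult_mult_eq])
      then show ?thesis
        using node.prems(2) b \<open>A' \<subseteq> A \<union> B\<close> by auto
    qed
    ultimately have "a \<otimes> x \<otimes> a \<in> Units (corner R a)"
      by (rule that(3))
    then obtain y where y: "y \<in> carrier (corner R a)" "y \<otimes> (a \<otimes> x \<otimes> a) = a" "(a \<otimes> x \<otimes> a) \<otimes> y = a"
      by (auto simp: Units_def)
    then have y': "y \<in> carrier R" "a \<otimes> y = y" "y \<otimes> a = y"
      by (auto simp: in_corner_iff[OF a])
    have "a \<otimes> x \<otimes> y = a" "y \<otimes> x \<otimes> a = a"
      using y(2,3) y'(1) a'(1) x by (simp_all add: m_assoc y'(2) y'(3)[THEN mult_mult_eq])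
    with y show ?thesis
      by blast
  qed
  obtain y where y: "y \<in> carrier (corner R u)" "u \<otimes> x \<otimes> y = u" "y \<otimes> x \<otimes> u = u"
    using block[OF t(1) Un_upper1 node.IH(1)] by blast
  obtain w where w: "w \<in> carrier (corner R v)" "v \<otimes> x \<otimes> w = v" "w \<otimes> x \<otimes> v = v"
    using block[OF t(2) Un_upper2 node.IH(2)] by blast
  show ?case
  proof (rule C.separated_block_unit)
    show "peirce_separated ?C u v"
      using node.hyps(5) by (simp add: peirce_separated_corner_iff[OF g])
    show "idempotent_of ?C u" "idempotent_of ?C v"
      using g(2,3) i by (simp_all add: idempotent_of_def)
    show "y \<in> carrier (corner ?C u)" "w \<in> carrier (corner ?C v)"
      using y(1) w(1) by (simp_all add: corner_corner[OF g(1)] g(2,3))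
  qed (simp_all add: node.hyps(3,4) node.prems(1) y(2,3) w(2,3))
qed

lemma peirce_tree_unit:
  assumes "peirce_tree R A \<one>" "x \<in> carrier R" "\<And>a. a \<in> A \<Longrightarrow> a \<otimes> x \<otimes> a = a"
  shows "x \<in> Units R"
proof -
  have 1: "idempotent_of R \<one>"
    by (simp add: idempotent_of_def)
  have "x \<in> Units (corner R \<one>)"
    using assms by (intro peirce_tree_unit_corner) (auto simp: in_corner_iff[OF 1])
  then show ?thesis
    by (auto simp: Units_def in_corner_iff[OF 1])
qed


lemma peirce_tree_component_mult:
  assumes "peirce_tree R A \<one>" "a \<in> A" "x \<in> carrier R" "y \<in> carrier R"
  shows "a \<otimes> (x \<otimes> y) \<otimes> a = (a \<otimes> x \<otimes> a) \<otimes> (a \<otimes> y \<otimes> a)"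
  using peirce_tree_diagonal_mult[OF assms] peirce_tree_absorb[OF assms(1,2)] assms(3,4)
  by (simp add: m_assoc mult_mult_eq[of a a a])

lemma peirce_tree_component_idempotent:
  assumes "peirce_tree R A \<one>" "a \<in> A" "idempotent_of R f"
  shows "idempotent_of R (a \<otimes> f \<otimes> a)"
  using peirce_tree_component_mult[OF assms(1,2), of f f] peirce_tree_absorb[OF assms(1,2)] assms(3)
  by (auto simp: idempotent_of_def)

text \<open>The classical witness \<open>s = ff' + (1 - f)(1 - f')\<close> satisfies \<open>fs = ff' = sf'\<close>. It is a unit since its diagonal is
that of \<open>f + (1 - f) = 1\<close>.\<close>

lemma peirce_tree_conjugate:
  assumes "peirce_tree R A \<one>" "idempotent_of R f" "idempotent_of R f'"
    and "\<And>a. a \<in> A \<Longrightarrow> a \<otimes> f \<otimes> a = a \<otimes> f' \<otimes> a"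
  shows "\<exists>s\<in>Units R. f \<otimes> s = s \<otimes> f'"
proof -
  note f = idempotentD[OF assms(2)] and f' = idempotentD[OF assms(3)]
  define c where "c = f \<otimes> f'"
  define s where "s = c \<oplus> (\<one> \<ominus> f) \<otimes> (\<one> \<ominus> f')"
  have c: "c \<in> carrier R"
    using f f' by (simp add: c_def)
  have s: "s \<in> carrier R"
    using f f' c by (simp add: s_def)
  have "f \<otimes> (\<one> \<ominus> f) = \<zero>" "(\<one> \<ominus> f') \<otimes> f' = \<zero>"
    using f f' by (simp_all add: a_minus_def r_distr l_distr r_minus l_minus r_neg)
  then have "f \<otimes> ((\<one> \<ominus> f) \<otimes> (\<one> \<ominus> f')) = \<zero>" "((\<one> \<ominus> f) \<otimes> (\<one> \<ominus> f')) \<otimes> f' = \<zero>"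
    using f f' by (simp_all add: mult_mult_eq[of f "\<one> \<ominus> f" \<zero>] m_assoc)
  moreover have "f \<otimes> c = c" "c \<otimes> f' = c"
    using f f' by (simp_all add: c_def m_assoc)
  ultimately have "f \<otimes> s = c" "s \<otimes> f' = c"
    using f(1) f'(1) c by (simp_all add: s_def l_distr r_distr)
  moreover have "a \<otimes> s \<otimes> a = a" if a: "a \<in> A" for a
  proof -
    note a' = peirce_tree_absorb[OF assms(1) a] and m = peirce_tree_component_mult[OF assms(1) a]
    define p where "p = a \<otimes> f \<otimes> a"
    have p: "p \<in> carrier R" "p \<otimes> p = p" "a \<otimes> p = p" "p \<otimes> a = p"
      using peirce_tree_component_idempotent[OF assms(1) a assms(2)] a' f(1)
      by (auto simp: p_def idempotent_of_def m_assoc a'(4)[THEN mult_mult_eq])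
    have p': "a \<otimes> f' \<otimes> a = p"
      using assms(4)[OF a] by (simp add: p_def)
    have "a \<otimes> c \<otimes> a = p"
      using m[OF f(1) f'(1)] p p' by (simp add: c_def p_def)
    moreover have "a \<otimes> (\<one> \<ominus> f) \<otimes> a = a \<ominus> p"
      using f(1) a' by (simp add: a_minus_def r_distr l_distr r_minus l_minus p_def)
    moreover have "a \<otimes> (\<one> \<ominus> f') \<otimes> a = a \<ominus> p"
      using f'(1) a' p' by (simp add: a_minus_def r_distr l_distr r_minus l_minus)
    ultimately have "a \<otimes> s \<otimes> a = p \<oplus> (a \<ominus> p) \<otimes> (a \<ominus> p)"
      using m[of "\<one> \<ominus> f" "\<one> \<ominus> f'"] f(1) f'(1) a'(1) c by (simp add: s_def r_distr l_distr)
    also have "\<dots> = a"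
      using a' p by (simp add: a_minus_def r_distr l_distr r_minus l_minus r_neg l_neg a_ac r_neg1 r_neg2)
    finally show ?thesis .
  qed
  ultimately show ?thesis
    using peirce_tree_unit[OF assms(1) s] by (intro bexI[of _ s]) simp_all
qed

section \<open>One-Peirce idempotents live in a single component\<close>

lemma peirce_separated_mono:
  assumes "peirce_separated R u v" "u \<in> carrier R" "v \<in> carrier R"
    and p: "p \<in> carrier R" "u \<otimes> p = p" "p \<otimes> u = p"
    and q: "q \<in> carrier R" "v \<otimes> q = q" "q \<otimes> v = q"
  shows "peirce_separated R p q"
  unfolding peirce_separated_def
proof (intro ballI conjI)
  fix x y assume xy: "x \<in> carrier R" "y \<in> carrier R"
  have "p \<otimes> x \<otimes> q \<otimes> y \<otimes> p = p \<otimes> (u \<otimes> x \<otimes> v \<otimes> (q \<otimes> y) \<otimes> u) \<otimes> p"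
    using xy assms(2,3) p q by (simp add: m_assoc p(3)[THEN mult_mult_eq] q(2)[THEN mult_mult_eq])
  then show "p \<otimes> x \<otimes> q \<otimes> y \<otimes> p = \<zero>"
    using assms(1) xy p q by (simp add: peirce_separated_def)
  have "q \<otimes> x \<otimes> p \<otimes> y \<otimes> q = q \<otimes> (v \<otimes> x \<otimes> u \<otimes> (p \<otimes> y) \<otimes> v) \<otimes> q"
    using xy assms(2,3) p q by (simp add: m_assoc p(2)[THEN mult_mult_eq] q(3)[THEN mult_mult_eq])
  then show "q \<otimes> x \<otimes> p \<otimes> y \<otimes> q = \<zero>"
    using assms(1) xy p q by (simp add: peirce_separated_def)
qed

lemma one_peirce_indecomposable:
  assumes "peirce_idempotent 1 R (p \<oplus> q)" "idempotent_of R p" "idempotent_of R q"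
    "p \<otimes> q = \<zero>" "q \<otimes> p = \<zero>" "peirce_separated R p q"
  shows "p = \<zero> \<or> q = \<zero>"
proof -
  have "peirce_trivial (corner R (p \<oplus> q)) p"
    using assms by (simp add: peirce_trivial_corner_iff)
  then have "p = \<zero> \<or> p = p \<oplus> q"
    using assms(1) unfolding peirce_idempotent_def peirce_ring_one_iff by auto
  moreover have "q = \<zero>" if "p = p \<oplus> q"
  proof -
    have "q = q \<otimes> (p \<oplus> q)"
      using assms(2,3,5) by (simp add: idempotent_of_def r_distr)
    also have "\<dots> = \<zero>"
      using assms(5) that by simp
    finally show ?thesis .
  qed
  ultimately show ?thesis
    by blast
qed

text \<open>The corner of \<open>f\<close> has no nontrivial Peirce trivial idempotents, while at every node \<open>u\<close>, \<open>v\<close> the products \<open>uf\<close>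
and \<open>vf\<close> split it in a Peirce trivial way. So one of them is zero and the descent continues into the other branch.\<close>

lemma one_peirce_in_component:
  assumes "peirce_tree R A g" "peirce_idempotent 1 R f" "g \<otimes> f = f"
    and "\<And>a. a \<in> A \<Longrightarrow> a \<otimes> f = f \<otimes> a"
  shows "\<exists>a\<in>A. a \<otimes> f = f"
  using assms
proof induction
  case (leaf a)
  then show ?case by simp
next
  case (node A u B v)
  note t = node.hyps(1,2)
  have f: "f \<in> carrier R" "f \<otimes> f = f"
    using node.prems(1) by (auto simp: peirce_idempotent_def idempotent_of_def)
  have u: "u \<in> carrier R" "u \<otimes> u = u" and v: "v \<in> carrier R" "v \<otimes> v = v"
    using t by (auto dest!: peirce_tree_facts(3) simp: idempotent_of_def)
  have comm: "g \<otimes> f = f \<otimes> g" if "peirce_tree R A' g" "A' \<subseteq> A \<union> B" for A' g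
  proof -
    have c: "(\<lambda>x. x) \<in> A' \<rightarrow> carrier R"
      using peirce_tree_absorb(1)[OF that(1)] by auto
    have "g \<otimes> f = (\<Oplus>a\<in>A'. a \<otimes> f)"
      using peirce_tree_facts(1,8)[OF that(1)] c f finsum_ldistr[of A' f "\<lambda>x. x"] by simp
    also have "\<dots> = (\<Oplus>a\<in>A'. f \<otimes> a)"
      using that(2) node.prems(3) f c by (intro finsum_cong') auto
    also have "\<dots> = f \<otimes> g"
      using peirce_tree_facts(1,8)[OF that(1)] c f finsum_rdistr[of A' f "\<lambda>x. x"] by simp
    finally show ?thesis .
  qed
  have uf: "u \<otimes> f = f \<otimes> u" and vf: "v \<otimes> f = f \<otimes> v"
    using comm t by auto
  have sum: "u \<otimes> f \<oplus> v \<otimes> f = f"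
    using node.prems(2) u v f by (simp add: l_distr)
  have "u \<otimes> f = \<zero> \<or> v \<otimes> f = \<zero>"
  proof (rule one_peirce_indecomposable)
    show "idempotent_of R (u \<otimes> f)" "idempotent_of R (v \<otimes> f)"
      using u v f uf vf by (metis idempotent_of_def m_assoc m_closed)+
    show "u \<otimes> f \<otimes> (v \<otimes> f) = \<zero>" "v \<otimes> f \<otimes> (u \<otimes> f) = \<zero>"
      using u v f uf vf node.hyps(3,4) by (metis m_assoc m_closed l_null r_null)+
    show "peirce_separated R (u \<otimes> f) (v \<otimes> f)"
      by (rule peirce_separated_mono[OF node.hyps(5)])
         (use u v f(1) in \<open>simp_all add: m_assoc uf[symmetric] vf[symmetric] u(2)[THEN mult_mult_eq] v(2)[THEN mult_mult_eq]\<close>)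
    show "peirce_idempotent 1 R (u \<otimes> f \<oplus> v \<otimes> f)"
      unfolding sum by (rule node.prems(1))
  qed
  then show ?case
  proof
    assume "u \<otimes> f = \<zero>"
    then have "v \<otimes> f = f"
      using sum v f by simp
    then show ?thesis
      using node.IH(2)[OF node.prems(1)] node.prems(3) by blast
  next
    assume "v \<otimes> f = \<zero>"
    then have "u \<otimes> f = f"
      using sum u f by simp
    then show ?thesis
      using node.IH(1)[OF node.prems(1)] node.prems(3) by blast
  qed
qed

definition diagonal_part :: "'a set \<Rightarrow> 'a \<Rightarrow> 'a" where
  "diagonal_part A x = (\<Oplus>a\<in>A. a \<otimes> x \<otimes> a)"

lemma diagonal_part_simps:
  assumes "peirce_tree R A g" "x \<in> carrier R"
  shows "diagonal_part A x \<in> carrier R"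
    and "a \<in> A \<Longrightarrow> a \<otimes> diagonal_part A x = a \<otimes> x \<otimes> a"
    and "a \<in> A \<Longrightarrow> diagonal_part A x \<otimes> a = a \<otimes> x \<otimes> a"
proof -
  note ab = peirce_tree_absorb[OF assms(1)]
  have c: "(\<lambda>a. a \<otimes> x \<otimes> a) \<in> A \<rightarrow> carrier R"
    using ab assms(2) by auto
  then show "diagonal_part A x \<in> carrier R"
    by (auto simp: diagonal_part_def)
  have 0: "b \<otimes> (a \<otimes> x \<otimes> a) = \<zero>" "(a \<otimes> x \<otimes> a) \<otimes> b = \<zero>" if "a \<in> A" "b \<in> A" "a \<noteq> b" for a b
  proof -
    have z: "b \<otimes> a = \<zero>" "a \<otimes> b = \<zero>"
      using peirce_tree_facts(7)[OF assms(1)] that by auto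
    show "b \<otimes> (a \<otimes> x \<otimes> a) = \<zero>" "(a \<otimes> x \<otimes> a) \<otimes> b = \<zero>"
      using ab(1)[OF that(1)] ab(1)[OF that(2)] assms(2) z z(1)[THEN mult_mult_eq] by (simp_all add: m_assoc)
  qed
  assume a: "a \<in> A"
  note aa = ab[OF a] ab(4)[OF a, THEN mult_mult_eq]
  show "a \<otimes> diagonal_part A x = a \<otimes> x \<otimes> a" unfolding diagonal_part_def
    by (rule finsum_absorb[OF peirce_tree_facts(1)[OF assms(1)] c _ a])
       (use aa assms(2) a 0 in \<open>auto simp: m_assoc\<close>)
  show "diagonal_part A x \<otimes> a = a \<otimes> x \<otimes> a" unfolding diagonal_part_def
    by (rule finsum_absorb_right[OF peirce_tree_facts(1)[OF assms(1)] c _ a])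
       (use aa assms(2) a 0 in \<open>auto simp: m_assoc\<close>)
qed

lemma idempotent_conjugate_diagonal_part:
  assumes "peirce_tree R A \<one>" "idempotent_of R f"
  shows "idempotent_of R (diagonal_part A f)"
    and "\<exists>s\<in>Units R. f \<otimes> s = s \<otimes> diagonal_part A f"
proof -
  note f = idempotentD[OF assms(2)] and ab = peirce_tree_absorb[OF assms(1)]
  note d = diagonal_part_simps[OF assms(1) f(1)]
  show i: "idempotent_of R (diagonal_part A f)"
    unfolding diagonal_part_def
  proof (rule orthogonal_sum_idempotent)
    show "finite A" by (rule peirce_tree_facts(1)[OF assms(1)])
    show "idempotent_of R (a \<otimes> f \<otimes> a)" if "a \<in> A" for a
      by (rule peirce_tree_component_idempotent[OF assms(1) that assms(2)])
    show "(a \<otimes> f \<otimes> a) \<otimes> (b \<otimes> f \<otimes> b) = \<zero>" if "a \<in> A" "b \<in> A" "a \<noteq> b" for a b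
      using peirce_tree_facts(7)[OF assms(1) that, THEN mult_mult_eq] ab(1)[OF that(1)] ab(1)[OF that(2)] f(1)
      by (simp add: m_assoc)
  qed
  have "a \<otimes> f \<otimes> a = a \<otimes> diagonal_part A f \<otimes> a" if "a \<in> A" for a
    using d(2)[OF that] ab[OF that] f(1) by (simp add: m_assoc)
  then show "\<exists>s\<in>Units R. f \<otimes> s = s \<otimes> diagonal_part A f"
    using peirce_tree_conjugate[OF assms i] by blast
qed

text \<open>The descent through the tree needs an idempotent that commutes with the leaves. The diagonal part of \<open>f\<close> does, and it
is conjugate to \<open>f\<close>, hence again one-Peirce.\<close>

lemma one_peirce_unique_component:
  assumes t: "peirce_tree R A \<one>" and f: "peirce_idempotent 1 R f"
  shows "\<exists>a. a \<in> A \<and> peirce_idempotent 1 R (a \<otimes> f \<otimes> a) \<and>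
    (\<forall>b\<in>A. b \<noteq> a \<longrightarrow> b \<otimes> f \<otimes> b = \<zero>) \<and>
    (\<exists>s\<in>Units R. f \<otimes> s = s \<otimes> (a \<otimes> f \<otimes> a))"
proof -
  have i: "idempotent_of R f"
    using f by (simp add: peirce_idempotent_def)
  note f' = idempotentD[OF i] and ab = peirce_tree_absorb[OF t]
  define d where "d = diagonal_part A f"
  note d' = diagonal_part_simps[OF t f'(1), folded d_def]
  obtain s where s: "s \<in> Units R" "f \<otimes> s = s \<otimes> d"
    using idempotent_conjugate_diagonal_part(2)[OF t i] by (auto simp: d_def)
  have "peirce_idempotent 1 R d"
    using conjugate_peirce_idempotent[OF _ d'(1) _ conjugate_sym[OF s(1) f'(1) d'(1) s(2)] f] s(1) f'(1) by simp
  moreover have "\<one> \<otimes> d = d" "\<And>a. a \<in> A \<Longrightarrow> a \<otimes> d = d \<otimes> a"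
    using d' by simp_all
  ultimately obtain a where a: "a \<in> A" "a \<otimes> d = d"
    using one_peirce_in_component[OF t] by blast
  then have eq: "a \<otimes> f \<otimes> a = d"
    using d'(2) by simp
  have "b \<otimes> f \<otimes> b = \<zero>" if b: "b \<in> A" "b \<noteq> a" for b
  proof -
    have "b \<otimes> f \<otimes> b = b \<otimes> (a \<otimes> d)"
      using d'(2)[OF b(1)] a by simp
    also have "\<dots> = \<zero>"
      using peirce_tree_facts(7)[OF t b(1) a(1) b(2), THEN mult_mult_eq] ab(1)[OF b(1)] ab(1)[OF a(1)] d'(1)
      by simp
    finally show ?thesis .
  qed
  then show ?thesis
    using a(1) s \<open>peirce_idempotent 1 R d\<close> eq
    by (intro exI[of _ a]) auto
qed

text \<open>Since compression is multiplicative, the compressions \<open>\<epsilon> j\<close> of orthogonal \<open>f j\<close> that fall into the same component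
remain orthogonal. The last three conclusions relate the sum of the family to the components that it meets; they
carry the counting arguments below.\<close>

lemma one_peirce_family_components:
  assumes t: "peirce_tree R A \<one>" and J: "finite J"
    and f: "\<And>j. j \<in> J \<Longrightarrow> peirce_idempotent 1 R (f j)"
    and orth: "\<And>i j. i \<in> J \<Longrightarrow> j \<in> J \<Longrightarrow> i \<noteq> j \<Longrightarrow> f i \<otimes> f j = \<zero>"
  obtains \<alpha> \<epsilon> where
    "\<And>j. j \<in> J \<Longrightarrow> \<alpha> j \<in> A"
    "\<And>j. j \<in> J \<Longrightarrow> \<epsilon> j \<in> carrier (corner R (\<alpha> j))"
    "\<And>j. j \<in> J \<Longrightarrow> peirce_idempotent 1 R (\<epsilon> j)"
    "\<And>j. j \<in> J \<Longrightarrow> \<exists>s\<in>Units R. f j \<otimes> s = s \<otimes> \<epsilon> j"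
    "\<And>i j. i \<in> J \<Longrightarrow> j \<in> J \<Longrightarrow> i \<noteq> j \<Longrightarrow> \<epsilon> i \<otimes> \<epsilon> j = \<zero>"
    "\<exists>s\<in>Units R. finsum R f J \<otimes> s = s \<otimes> finsum R \<epsilon> J"
    "\<And>a. a \<in> A \<Longrightarrow> a \<otimes> finsum R f J \<otimes> a \<noteq> \<zero> \<Longrightarrow> a \<in> \<alpha> ` J"
    "\<And>j. inj_on \<alpha> J \<Longrightarrow> j \<in> J \<Longrightarrow> \<alpha> j \<otimes> finsum R f J \<otimes> \<alpha> j = \<epsilon> j"
    "\<And>j a. j \<in> J \<Longrightarrow> a \<in> A \<Longrightarrow> a \<otimes> f j \<otimes> a = (if a = \<alpha> j then \<epsilon> j else \<zero>)"
proof -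
  note ab = peirce_tree_absorb[OF t]
  have "\<forall>j\<in>J. \<exists>a. a \<in> A \<and> peirce_idempotent 1 R (a \<otimes> f j \<otimes> a) \<and>
      (\<forall>b\<in>A. b \<noteq> a \<longrightarrow> b \<otimes> f j \<otimes> b = \<zero>) \<and> (\<exists>s\<in>Units R. f j \<otimes> s = s \<otimes> (a \<otimes> f j \<otimes> a))"
    using one_peirce_unique_component[OF t f] by simp
  from bchoice[OF this] obtain \<alpha> where \<alpha>: "\<And>j. j \<in> J \<Longrightarrow> \<alpha> j \<in> A"
    "\<And>j. j \<in> J \<Longrightarrow> peirce_idempotent 1 R (\<alpha> j \<otimes> f j \<otimes> \<alpha> j)"
    "\<And>j b. j \<in> J \<Longrightarrow> b \<in> A \<Longrightarrow> b \<noteq> \<alpha> j \<Longrightarrow> b \<otimes> f j \<otimes> b = \<zero>"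
    "\<And>j. j \<in> J \<Longrightarrow> \<exists>s\<in>Units R. f j \<otimes> s = s \<otimes> (\<alpha> j \<otimes> f j \<otimes> \<alpha> j)"
    by blast
  define \<epsilon> where "\<epsilon> j = \<alpha> j \<otimes> f j \<otimes> \<alpha> j" for j
  have fi: "idempotent_of R (f j)" if "j \<in> J" for j
    using f[OF that] by (simp add: peirce_idempotent_def)
  have fc: "f \<in> J \<rightarrow> carrier R"
    using fi by (auto simp: idempotent_of_def)
  have ec: "\<epsilon> \<in> J \<rightarrow> carrier R"
    using fc ab(1)[OF \<alpha>(1)] by (simp add: \<epsilon>_def Pi_iff)
  have f_in: "f j \<in> carrier R" and e_in: "\<epsilon> j \<in> carrier R" if "j \<in> J" for j
    using fc ec that by auto
  have ei: "idempotent_of R (\<epsilon> j)" if "j \<in> J" for j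
    using \<alpha>(2)[OF that] by (simp add: peirce_idempotent_def \<epsilon>_def)
  have comp: "a \<otimes> f j \<otimes> a = (if a = \<alpha> j then \<epsilon> j else \<zero>)" if "j \<in> J" "a \<in> A" for j a
    using \<alpha>(3)[OF that] by (auto simp: \<epsilon>_def)
  have acomp: "\<alpha> j \<otimes> \<epsilon> j = \<epsilon> j" "\<epsilon> j \<otimes> \<alpha> j = \<epsilon> j" if "j \<in> J" for j
    using ab[OF \<alpha>(1)[OF that]] ab(4)[OF \<alpha>(1)[OF that], THEN mult_mult_eq] f_in[OF that]
    by (simp_all add: \<epsilon>_def m_assoc)
  have eorth: "\<epsilon> i \<otimes> \<epsilon> j = \<zero>" if ij: "i \<in> J" "j \<in> J" "i \<noteq> j" for i j
  proof (cases "\<alpha> i = \<alpha> j")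
    case True
    have "\<epsilon> i \<otimes> \<epsilon> j = \<alpha> j \<otimes> (f i \<otimes> f j) \<otimes> \<alpha> j"
      using peirce_tree_component_mult[OF t \<alpha>(1)[OF ij(2)] f_in[OF ij(1)] f_in[OF ij(2)]] True
      by (simp add: \<epsilon>_def)
    then show ?thesis
      using orth[OF ij] ab(1)[OF \<alpha>(1)[OF ij(2)]] by simp
  next
    case False
    have "\<epsilon> i \<otimes> \<epsilon> j = \<epsilon> i \<otimes> (\<alpha> i \<otimes> \<alpha> j) \<otimes> \<epsilon> j"
      using acomp(1)[OF ij(2)] acomp(2)[OF ij(1), THEN mult_mult_eq] e_in[OF ij(1)] e_in[OF ij(2)]
        ab(1)[OF \<alpha>(1)[OF ij(1)]] ab(1)[OF \<alpha>(1)[OF ij(2)]] by (simp add: m_assoc)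
    then show ?thesis
      using peirce_tree_facts(7)[OF t \<alpha>(1)[OF ij(1)] \<alpha>(1)[OF ij(2)] False] e_in[OF ij(1)] e_in[OF ij(2)]
      by simp
  qed
  have sandwich_f: "a \<otimes> finsum R f J \<otimes> a = (\<Oplus>j\<in>J. if a = \<alpha> j then \<epsilon> j else \<zero>)" if "a \<in> A" for a
  proof -
    have "a \<otimes> finsum R f J \<otimes> a = (\<Oplus>j\<in>J. a \<otimes> f j \<otimes> a)"
      using finsum_sandwich[OF J fc] ab(1)[OF that] by simp
    also have "\<dots> = (\<Oplus>j\<in>J. if a = \<alpha> j then \<epsilon> j else \<zero>)"
      using comp that e_in by (intro finsum_cong') auto
    finally show ?thesis .
  qed
  have sandwich_e: "a \<otimes> finsum R \<epsilon> J \<otimes> a = (\<Oplus>j\<in>J. if a = \<alpha> j then \<epsilon> j else \<zero>)" if a: "a \<in> A" for a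
  proof -
    have "a \<otimes> finsum R \<epsilon> J \<otimes> a = (\<Oplus>j\<in>J. a \<otimes> \<epsilon> j \<otimes> a)"
      using finsum_sandwich[OF J ec] ab(1)[OF a] by simp
    also have "\<dots> = (\<Oplus>j\<in>J. if a = \<alpha> j then \<epsilon> j else \<zero>)"
    proof (intro finsum_cong')
      fix j assume j: "j \<in> J"
      show "a \<otimes> \<epsilon> j \<otimes> a = (if a = \<alpha> j then \<epsilon> j else \<zero>)"
      proof (cases "a = \<alpha> j")
        case True
        then show ?thesis using acomp[OF j] by simp
      next
        case False
        have "a \<otimes> \<epsilon> j = (a \<otimes> \<alpha> j) \<otimes> \<epsilon> j"
          using acomp(1)[OF j] ab(1)[OF a] ab(1)[OF \<alpha>(1)[OF j]] e_in[OF j] by (simp add: m_assoc)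
        then show ?thesis
          using peirce_tree_facts(7)[OF t a \<alpha>(1)[OF j] False] False e_in[OF j] ab(1)[OF a] by simp
      qed
    qed (use e_in in auto)
    finally show ?thesis .
  qed
  have surj: "a \<in> \<alpha> ` J" if "a \<in> A" "a \<otimes> finsum R f J \<otimes> a \<noteq> \<zero>" for a
  proof (rule ccontr)
    assume "a \<notin> \<alpha> ` J"
    then have "(\<Oplus>j\<in>J. if a = \<alpha> j then \<epsilon> j else \<zero>) = (\<Oplus>j\<in>J. \<zero>)"
      by (intro finsum_cong') auto
    then show False
      using sandwich_f[OF that(1)] that(2) by simp
  qed
  have single: "\<alpha> j \<otimes> finsum R f J \<otimes> \<alpha> j = \<epsilon> j" if inj: "inj_on \<alpha> J" and j: "j \<in> J" for j
  proof -
    have "(\<Oplus>i\<in>J. if \<alpha> j = \<alpha> i then \<epsilon> i else \<zero>) = (\<Oplus>i\<in>J. if j = i then \<epsilon> i else \<zero>)"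
      using inj j e_in by (intro finsum_cong') (auto simp: inj_on_def)
    then show ?thesis
      using sandwich_f[OF \<alpha>(1)[OF j]] finsum_singleton[OF j J ec] by simp
  qed
  have sandwich: "a \<otimes> finsum R f J \<otimes> a = a \<otimes> finsum R \<epsilon> J \<otimes> a" if "a \<in> A" for a
    by (simp only: sandwich_f[OF that] sandwich_e[OF that])
  show ?thesis
  proof (rule that[of \<alpha> \<epsilon>])
    show "\<epsilon> j \<in> carrier (corner R (\<alpha> j))" if "j \<in> J" for j
      using f_in[OF that] by (auto simp: corner_def \<epsilon>_def)
    show "\<exists>s\<in>Units R. finsum R f J \<otimes> s = s \<otimes> finsum R \<epsilon> J"
      by (rule peirce_tree_conjugate[OF t orthogonal_sum_idempotent[OF J fi orth]
            orthogonal_sum_idempotent[OF J ei eorth] sandwich])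
    show "peirce_idempotent 1 R (\<epsilon> j)" "\<exists>s\<in>Units R. f j \<otimes> s = s \<otimes> \<epsilon> j" if "j \<in> J" for j
      using \<alpha>(2,4)[OF that] by (simp_all only: \<epsilon>_def)
  qed (fact \<alpha>(1) eorth surj single comp)+
qed


section \<open>The number of leaves is an invariant\<close>

lemma corner_mono:
  assumes "idempotent_of R g" "idempotent_of R u" "u \<in> carrier (corner R g)" "x \<in> carrier (corner R u)"
  shows "x \<in> carrier (corner R g)"
proof -
  have u: "u \<in> carrier R" "g \<otimes> u = u" "u \<otimes> g = u" and x: "x \<in> carrier R" "u \<otimes> x = x" "x \<otimes> u = x"
    and g: "g \<in> carrier R"
    using assms by (auto simp: in_corner_iff idempotent_of_def)
  have "g \<otimes> x = x" "x \<otimes> g = x"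
    using u x g by (metis m_assoc)+
  then show ?thesis
    using x in_corner_iff[OF assms(1)] by simp
qed

lemma peirce_tree_subset:
  assumes "peirce_tree R A g" "K \<subseteq> A" "K \<noteq> {}"
  shows "\<exists>u. peirce_tree R K u \<and> u \<in> carrier (corner R g)"
  using assms
proof (induction arbitrary: K)
  case (leaf a)
  then have "K = {a}" "idempotent_of R a"
    by (auto simp: peirce_idempotent_def)
  then show ?case
    using peirce_tree.leaf[OF leaf.hyps] by (auto simp: in_corner_iff idempotent_of_def)
next
  case (node A u B v)
  note t = node.hyps(1,2)
  have i: "idempotent_of R u" "idempotent_of R v"
    using t by (auto dest: peirce_tree_facts(3))
  note uv = idempotentD(1)[OF i(1)] idempotentD(1)[OF i(2)]
  note g = idempotent_add[OF i node.hyps(3,4)]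
  consider "K \<inter> B = {}" | "K \<inter> A = {}" | "K \<inter> A \<noteq> {}" "K \<inter> B \<noteq> {}"
    by blast
  then show ?case
  proof cases
    case 1
    then have "K \<subseteq> A"
      using node.prems(1) by blast
    from node.IH(1)[OF this node.prems(2)] show ?thesis
      using corner_mono[OF g(1) i(1) g(2)] by blast
  next
    case 2
    then have "K \<subseteq> B"
      using node.prems(1) by blast
    from node.IH(2)[OF this node.prems(2)] show ?thesis
      using corner_mono[OF g(1) i(2) g(3)] by blast
  next
    case 3
    obtain p where p: "peirce_tree R (K \<inter> A) p" "p \<in> carrier (corner R u)"
      using node.IH(1)[OF Int_lower2 3(1)] by blast
    obtain q where q: "peirce_tree R (K \<inter> B) q" "q \<in> carrier (corner R v)"
      using node.IH(2)[OF Int_lower2 3(2)] by blast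
    have p': "p \<in> carrier R" "u \<otimes> p = p" "p \<otimes> u = p" and q': "q \<in> carrier R" "v \<otimes> q = q" "q \<otimes> v = q"
      using p(2) q(2) by (auto simp: in_corner_iff[OF i(1)] in_corner_iff[OF i(2)])
    have pq: "p \<otimes> q = \<zero>" "q \<otimes> p = \<zero>"
      using p' q' uv node.hyps(3,4) by (metis m_assoc l_null r_null)+
    have "peirce_tree R ((K \<inter> A) \<union> (K \<inter> B)) (p \<oplus> q)"
      by (rule peirce_tree.node[OF p(1) q(1) pq peirce_separated_mono[OF node.hyps(5) uv p' q']])
    moreover have "(K \<inter> A) \<union> (K \<inter> B) = K"
      using node.prems(1) by blast
    moreover have "p \<oplus> q \<in> carrier (corner R (u \<oplus> v))"
    proof -
      interpret C: ring "corner R (u \<oplus> v)" by (rule ring_corner[OF g(1)])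
      show ?thesis
        using C.a_closed corner_mono[OF g(1) i(1) g(2) p(2)] corner_mono[OF g(1) i(2) g(3) q(2)] by simp
    qed
    ultimately show ?thesis
      by auto
  qed
qed

lemma peirce_tree_imp_peirce_idempotent:
  assumes "peirce_tree R A g"
  shows "peirce_idempotent (card A) R g"
  using assms
proof induction
  case (leaf a)
  then show ?case by simp
next
  case (node A u B v)
  note t = node.hyps(1,2)
  have i: "idempotent_of R u" "idempotent_of R v"
    using t by (auto dest: peirce_tree_facts(3))
  note g = idempotent_add[OF i node.hyps(3,4)]
  have fin: "finite A" "finite B" "A \<noteq> {}" "B \<noteq> {}"
    using t by (auto dest: peirce_tree_facts(1,2))
  have pos: "card A > 0" "card B > 0"
    using fin by (auto simp: card_gt_0_iff)
  have card: "card (A \<union> B) = card A + card B"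
    using fin peirce_tree_node_disjoint[OF t node.hyps(3)] by (simp add: card_Un_disjoint)
  interpret C: ring "corner R (u \<oplus> v)" by (rule ring_corner[OF g(1)])
  have minus: "\<one>\<^bsub>corner R (u \<oplus> v)\<^esub> \<ominus>\<^bsub>corner R (u \<oplus> v)\<^esub> u = v"
    using corner_minus[OF g(1) C.one_closed g(2)] i minus_add_cancel
    by (simp add: idempotent_of_def)
  have "peirce_ring (card A + card B) (corner R (u \<oplus> v))"
  proof (rule peirce_ring.split)
    show "peirce_trivial (corner R (u \<oplus> v)) u"
      using peirce_trivial_corner_iff[OF i node.hyps(3,4)] node.hyps(5) by simp
    show "peirce_ring (card A) (corner (corner R (u \<oplus> v)) u)"
      using node.IH(1) by (simp add: corner_corner[OF g(1,2)] peirce_idempotent_def)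
    show "peirce_ring (card A + card B - card A)
        (corner (corner R (u \<oplus> v)) (\<one>\<^bsub>corner R (u \<oplus> v)\<^esub> \<ominus>\<^bsub>corner R (u \<oplus> v)\<^esub> u))"
      unfolding minus using node.IH(2) by (simp add: corner_corner[OF g(1,3)] peirce_idempotent_def)
  qed (use pos C.ring_axioms in auto)
  then show ?case
    using g(1) card by (simp add: peirce_idempotent_def)
qed

lemma peirce_tree_of_corner:
  assumes "idempotent_of R g" "peirce_tree (corner R g) A a"
  shows "peirce_tree R A a"
  using assms(2)
proof induction
  case (leaf a)
  then have "a \<in> carrier (corner R g)"
    by (simp add: peirce_idempotent_def idempotent_of_def)
  then show ?case
    using leaf peirce_idempotent_corner_iff[OF assms(1)] by (blast intro: peirce_tree.leaf)
next
  case (node A u B v)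
  interpret C: ring "corner R g" by (rule ring_corner[OF assms(1)])
  have "u \<in> carrier (corner R g)" "v \<in> carrier (corner R g)"
    using C.peirce_tree_facts(3)[OF node.hyps(1)] C.peirce_tree_facts(3)[OF node.hyps(2)]
    by (simp_all add: idempotent_of_def)
  then have "peirce_separated R u v"
    using node.hyps(5) peirce_separated_corner_iff[OF assms(1)] by blast
  then show ?case
    using peirce_tree.node[OF node.IH] node.hyps(3,4) by simp
qed

text \<open>Decompose \<open>1\<close> along \<open>B\<close>: every component \<open>a\<close> in \<open>A\<close> meets \<open>1\<close>, so it contains the compression of some member of \<open>B\<close>,
and each member of \<open>B\<close> meets only one component.\<close>

lemma peirce_trees_card_le:
  assumes "peirce_tree R A \<one>" "peirce_tree R B \<one>"
  shows "card A \<le> card B"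
proof -
  obtain \<alpha> :: "'a \<Rightarrow> 'a" where "\<And>a. a \<in> A \<Longrightarrow> a \<otimes> finsum R (\<lambda>x. x) B \<otimes> a \<noteq> \<zero> \<Longrightarrow> a \<in> \<alpha> ` B"
    by (rule one_peirce_family_components[where f = "\<lambda>x. x" and J = B,
          OF assms(1) peirce_tree_facts(1,5,7)[OF assms(2)]]) blast+
  moreover have "a \<otimes> \<one> \<otimes> a \<noteq> \<zero>" if "a \<in> A" for a
    using peirce_tree_absorb[OF assms(1) that] one_peirce_nonzero[OF peirce_tree_facts(5)[OF assms(1) that]]
    by simp
  ultimately have "A \<subseteq> \<alpha> ` B"
    using peirce_tree_facts(8)[OF assms(2)] by auto
  then show ?thesis
    using peirce_tree_facts(1)[OF assms(2)] by (meson card_image_le card_mono finite_imageI le_trans)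
qed

end

lemma peirce_ring_imp_peirce_tree:
  assumes "peirce_ring n R" "n \<noteq> 0"
  shows "\<exists>A. peirce_tree R A \<one>\<^bsub>R\<^esub> \<and> card A = n"
  using assms
proof induction
  case (zero R)
  then show ?case by simp
next
  case (one R)
  interpret ring R by (rule one.hyps(1))
  have i: "idempotent_of R \<one>\<^bsub>R\<^esub>"
    by (simp add: idempotent_of_def)
  have "(\<lambda>x. x) \<in> ring_iso R (corner R \<one>\<^bsub>R\<^esub>)"
    by (intro ring_iso_memI) (auto simp: in_corner_iff[OF i] bij_betw_def)
  then have "peirce_ring 1 (corner R \<one>\<^bsub>R\<^esub>)"
    using peirce_ring_iso[OF peirce_ring.one[OF one.hyps]] ring_corner[OF i] by blast
  then have "peirce_tree R {\<one>\<^bsub>R\<^esub>} \<one>\<^bsub>R\<^esub>"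
    using i by (intro peirce_tree.leaf) (simp add: peirce_idempotent_def)
  then show ?case
    by (intro exI[of _ "{\<one>\<^bsub>R\<^esub>}"]) simp
next
  case (split R n e m)
  interpret ring R by (rule split.hyps(1))
  have e: "idempotent_of R e" and sep: "peirce_separated R e (\<one>\<^bsub>R\<^esub> \<ominus>\<^bsub>R\<^esub> e)"
    using split.hyps(3) peirce_trivial_iff_separated by auto
  note c = idempotent_complement[OF e]
  obtain A where A: "peirce_tree (corner R e) A e" "card A = m"
    using split.IH(1) split.hyps(4) by auto
  obtain B where B: "peirce_tree (corner R (\<one>\<^bsub>R\<^esub> \<ominus>\<^bsub>R\<^esub> e)) B (\<one>\<^bsub>R\<^esub> \<ominus>\<^bsub>R\<^esub> e)" "card B = n - m"
    using split.IH(2) split.hyps(5) by auto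
  note t = peirce_tree_of_corner[OF e A(1)] peirce_tree_of_corner[OF c(1) B(1)]
  have "peirce_tree R (A \<union> B) \<one>\<^bsub>R\<^esub>"
    using peirce_tree.node[OF t c(2,3) sep] c(4) by simp
  moreover have "card (A \<union> B) = n"
    using t[THEN peirce_tree_facts(1)] peirce_tree_node_disjoint[OF t c(2)] A(2) B(2) split.hyps(5)
    by (simp add: card_Un_disjoint)
  ultimately show ?case
    by blast
qed

lemma peirce_ring_unique:
  assumes "peirce_ring n R" "peirce_ring m R"
  shows "n = m"
proof -
  interpret ring R by (rule peirce_ring_imp_ring[OF assms(1)])
  have trees: "card A = card B" if "peirce_tree R A \<one>\<^bsub>R\<^esub>" "peirce_tree R B \<one>\<^bsub>R\<^esub>" for A B
    using peirce_trees_card_le that by (simp add: le_antisym)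
  have nz: "m = 0" if zero: "peirce_ring 0 R" and m: "peirce_ring m R" for m
  proof (rule ccontr)
    assume "m \<noteq> 0"
    then obtain A where "peirce_tree R A \<one>\<^bsub>R\<^esub>"
      using peirce_ring_imp_peirce_tree m by blast
    then have "\<one>\<^bsub>R\<^esub> \<noteq> \<zero>\<^bsub>R\<^esub>"
      by (rule peirce_tree_facts(4))
    moreover have "\<one>\<^bsub>R\<^esub> = \<zero>\<^bsub>R\<^esub>"
      using zero by (cases rule: peirce_ring.cases) auto
    ultimately show False
      by simp
  qed
  show ?thesis
  proof (cases "n = 0 \<or> m = 0")
    case True
    then show ?thesis
      using nz assms by metis
  next
    case False
    then show ?thesis
      using trees peirce_ring_imp_peirce_tree[OF assms(1)] peirce_ring_imp_peirce_tree[OF assms(2)] by metis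
  qed
qed

context ring
begin

section \<open>Peirce trivial idempotents and full decompositions\<close>

text \<open>After replacing \<open>f\<close> by its diagonal part \<open>d\<close>, which commutes with \<open>a\<close>, the splitting of \<open>a\<close> into \<open>ad\<close> and
\<open>a(1 - d)\<close> is separated, and \<open>a\<close> is one-Peirce.\<close>

lemma peirce_trivial_component:
  assumes t: "peirce_tree R A \<one>" and f: "peirce_trivial R f" and a: "a \<in> A"
  shows "a \<otimes> f \<otimes> a = \<zero> \<or> a \<otimes> f \<otimes> a = a"
proof -
  have i: "idempotent_of R f"
    using f by (simp add: peirce_trivial_iff_separated)
  define d where "d = diagonal_part A f"
  note d = diagonal_part_simps[OF t idempotentD(1)[OF i], folded d_def]
  obtain s where "s \<in> Units R" "f \<otimes> s = s \<otimes> d"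
    using idempotent_conjugate_diagonal_part(2)[OF t i] d_def by blast
  then have "peirce_trivial R d"
    using conjugate_peirce_trivial[OF _ idempotentD(1)[OF i] d(1)] f by blast
  then have di: "idempotent_of R d" and sep: "peirce_separated R d (\<one> \<ominus> d)"
    by (simp_all add: peirce_trivial_iff_separated)
  note c = idempotent_complement[OF di] and a' = peirce_tree_absorb[OF t a]
  note dd = idempotentD[OF di] idempotentD[OF c(1)]
  have ad: "a \<otimes> d = d \<otimes> a"
    using d(2,3)[OF a] by simp
  have ac: "a \<otimes> (\<one> \<ominus> d) = (\<one> \<ominus> d) \<otimes> a"
    using ad a'(1) dd(1) by (simp add: a_minus_def l_distr r_distr l_minus r_minus)
  have comm: "idempotent_of R (a \<otimes> x)" if x: "idempotent_of R x" "a \<otimes> x = x \<otimes> a" for x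
    using a' idempotentD[OF x(1)] x(2) by (metis idempotent_of_def m_assoc m_closed)
  have prod: "a \<otimes> x \<otimes> (a \<otimes> y) = \<zero>"
    if "x \<in> carrier R" "y \<in> carrier R" "x \<otimes> y = \<zero>" "a \<otimes> y = y \<otimes> a" for x y
    using a'(1) that mult_mult_eq[OF that(3,1,2) a'(1)] by (simp add: m_assoc)
  have "a \<otimes> d \<oplus> a \<otimes> (\<one> \<ominus> d) = a"
    using a'(1) dd(1,4) c(4) by (simp flip: r_distr)
  moreover have "peirce_separated R (a \<otimes> d) (a \<otimes> (\<one> \<ominus> d))"
    by (rule peirce_separated_mono[OF sep dd(1,4)])
       (use a'(1) dd in \<open>simp_all add: m_assoc, simp_all add: ad ac\<close>)
  ultimately have "a \<otimes> d = \<zero> \<or> a \<otimes> (\<one> \<ominus> d) = \<zero>"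
    using one_peirce_indecomposable[of "a \<otimes> d" "a \<otimes> (\<one> \<ominus> d)"] peirce_tree_facts(5)[OF t a]
      comm[OF di ad] comm[OF c(1) ac] prod[OF dd(1,4) c(2) ac] prod[OF dd(4,1) c(3) ad] by simp
  then show ?thesis
    using \<open>a \<otimes> d \<oplus> a \<otimes> (\<one> \<ominus> d) = a\<close> d(2)[OF a] a'(1) dd(1,4) idempotentD(1)[OF i] by auto
qed

text \<open>Each component of \<open>f\<close> is \<open>0\<close> or \<open>a\<close>, so \<open>f\<close> is conjugate to the sum of the leaves in \<open>K\<close>, and these leaves again form
a tree. The empty \<open>K\<close> has no tree; there \<open>f = 0\<close>.\<close>

lemma peirce_trivial_imp_peirce_idempotent:
  assumes t: "peirce_tree R A \<one>" and f: "peirce_trivial R f"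
  defines "K \<equiv> {a \<in> A. a \<otimes> f \<otimes> a = a}"
  shows "peirce_idempotent (card K) R f"
proof -
  have i: "idempotent_of R f"
    using f by (simp add: peirce_trivial_iff_separated)
  note ab = peirce_tree_absorb[OF t]
  have K: "K \<subseteq> A" "finite K"
    using peirce_tree_facts(1)[OF t] by (auto simp: K_def)
  define u where "u = finsum R (\<lambda>x. x) K"
  have ui: "idempotent_of R u"
    unfolding u_def
  proof (rule orthogonal_sum_idempotent[OF K(2)])
    show "idempotent_of R j" if "j \<in> K" for j
      using ab K that by (auto simp: idempotent_of_def)
    show "i \<otimes> j = \<zero>" if "i \<in> K" "j \<in> K" "i \<noteq> j" for i j
      using peirce_tree_facts(7)[OF t] K that by blast
  qed
  have c: "(\<lambda>x. x) \<in> K \<rightarrow> carrier R"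
    using ab(1) K(1) by blast
  have "a \<otimes> f \<otimes> a = a \<otimes> u \<otimes> a" if a: "a \<in> A" for a
  proof (cases "a \<in> K")
    case True
    have "a \<otimes> u = a"
      unfolding u_def
      by (rule finsum_absorb[OF K(2) c _ True])
         (use ab[OF a] peirce_tree_facts(7)[OF t a] K in auto)
    then show ?thesis
      using True ab(4)[OF a] by (simp add: K_def)
  next
    case False
    then have "a \<otimes> f \<otimes> a = \<zero>"
      using peirce_trivial_component[OF t f a] a by (auto simp: K_def)
    moreover have "a \<otimes> u = (\<Oplus>x\<in>K. a \<otimes> x)"
      unfolding u_def using K(2) c ab(1)[OF a] by (simp add: finsum_rdistr)
    moreover have "(\<Oplus>x\<in>K. a \<otimes> x) = (\<Oplus>x\<in>K. \<zero>)"
      using peirce_tree_facts(7)[OF t a] K False by (intro finsum_cong') auto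
    ultimately show ?thesis
      using ab(1)[OF a] by simp
  qed
  from peirce_tree_conjugate[OF t i ui this] obtain s where s: "s \<in> Units R" "f \<otimes> s = s \<otimes> u"
    by blast
  have "peirce_idempotent (card K) R u"
  proof (cases "K = {}")
    case True
    then have "u = \<zero>"
      by (simp add: u_def)
    then show ?thesis
      using True ui ring_corner[OF ui] peirce_ring.zero[of "corner R \<zero>"] by (simp add: peirce_idempotent_def)
  next
    case False
    then obtain v where v: "peirce_tree R K v"
      using peirce_tree_subset[OF t K(1)] by blast
    then have "v = u"
      using peirce_tree_facts(8) u_def by metis
    then show ?thesis
      using peirce_tree_imp_peirce_idempotent[OF v] by simp
  qed
  then show ?thesis
    using conjugate_peirce_idempotent[OF s(1) _ _ s(2)] i ui by (simp add: idempotent_of_def)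
qed

text \<open>Counting makes \<open>\<alpha>\<close> a bijection, and then the compression of \<open>f j\<close> is all of \<open>\<alpha> j\<close>. The single element
\<open>s = \<Sum> f j \<alpha> j\<close> conjugates all \<open>\<alpha> j\<close> to \<open>f j\<close> at once; it is a unit because its diagonal is \<open>1\<close>.\<close>

lemma one_peirce_decomposition_conjugate:
  assumes t: "peirce_tree R A \<one>" and J: "finite J" "card J \<le> card A"
    and f: "\<And>j. j \<in> J \<Longrightarrow> peirce_idempotent 1 R (f j)"
    and orth: "\<And>i j. i \<in> J \<Longrightarrow> j \<in> J \<Longrightarrow> i \<noteq> j \<Longrightarrow> f i \<otimes> f j = \<zero>"
    and sum: "finsum R f J = \<one>"
  shows "\<exists>s\<in>Units R. \<exists>\<alpha>. bij_betw \<alpha> J A \<and> (\<forall>j\<in>J. f j = s \<otimes> \<alpha> j \<otimes> inv s)"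
proof -
  note ab = peirce_tree_absorb[OF t]
  have A: "finite A"
    by (rule peirce_tree_facts(1)[OF t])
  obtain \<alpha> \<epsilon> where \<alpha>: "\<And>j. j \<in> J \<Longrightarrow> \<alpha> j \<in> A"
    and surj: "\<And>a. a \<in> A \<Longrightarrow> a \<otimes> finsum R f J \<otimes> a \<noteq> \<zero> \<Longrightarrow> a \<in> \<alpha> ` J"
    and single: "\<And>j. inj_on \<alpha> J \<Longrightarrow> j \<in> J \<Longrightarrow> \<alpha> j \<otimes> finsum R f J \<otimes> \<alpha> j = \<epsilon> j"
    and comp: "\<And>j a. j \<in> J \<Longrightarrow> a \<in> A \<Longrightarrow> a \<otimes> f j \<otimes> a = (if a = \<alpha> j then \<epsilon> j else \<zero>)"
    by (rule one_peirce_family_components[OF t J(1) f orth]) blast+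
  have "A \<subseteq> \<alpha> ` J"
    using surj sum ab one_peirce_nonzero[OF peirce_tree_facts(5)[OF t]] by simp blast
  then have im: "\<alpha> ` J = A"
    using \<alpha> by blast
  then have "card J = card A"
    using J card_image_le[OF J(1), of \<alpha>] by simp
  then have inj: "inj_on \<alpha> J"
    using im J(1) by (intro eq_card_imp_inj_on) simp_all
  have comp': "\<alpha> j \<otimes> f j \<otimes> \<alpha> j = \<alpha> j" if "j \<in> J" for j
    using single[OF inj that] comp[OF that \<alpha>[OF that]] sum ab[OF \<alpha>[OF that]] by simp
  have fc: "f j \<in> carrier R" "f j \<otimes> f j = f j" if "j \<in> J" for j
    using f[OF that] by (auto simp: peirce_idempotent_def idempotent_of_def)
  note ac = ab[OF \<alpha>]
  have oa: "\<alpha> i \<otimes> \<alpha> j = \<zero>" if "i \<in> J" "j \<in> J" "i \<noteq> j" for i j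
    using peirce_tree_facts(7)[OF t \<alpha> \<alpha>] inj that by (auto simp: inj_on_def)
  define s where "s = (\<Oplus>j\<in>J. f j \<otimes> \<alpha> j)"
  have sc: "(\<lambda>j. f j \<otimes> \<alpha> j) \<in> J \<rightarrow> carrier R"
    using fc ac by auto
  have fs: "f j \<otimes> s = f j \<otimes> \<alpha> j" if j: "j \<in> J" for j
    unfolding s_def
    by (rule finsum_absorb[OF J(1) sc _ j])
       (use fc[OF j] ac[OF j] fc ac orth[OF j] j fc(2)[OF j, THEN mult_mult_eq] orth[OF j, THEN mult_mult_eq] in auto)
  have sa: "s \<otimes> \<alpha> j = f j \<otimes> \<alpha> j" if j: "j \<in> J" for j
    unfolding s_def
    by (rule finsum_absorb_right[OF J(1) sc _ j])
       (use fc[OF j] ac[OF j] fc ac oa j in \<open>auto simp: m_assoc\<close>)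
  have "a \<otimes> s \<otimes> a = a" if "a \<in> A" for a
  proof -
    obtain j where j: "j \<in> J" "a = \<alpha> j"
      using im \<open>a \<in> A\<close> by blast
    have "a \<otimes> s \<otimes> a = a \<otimes> (s \<otimes> \<alpha> j)"
      using j ac sc s_def by (simp add: m_assoc)
    then show ?thesis
      using sa[OF j(1)] comp'[OF j(1)] fc[OF j(1)] ac[OF j(1)] j(2) by (simp add: m_assoc)
  qed
  then have "s \<in> Units R"
    using sc by (intro peirce_tree_unit[OF t]) (auto simp: s_def)
  moreover have "f j = s \<otimes> \<alpha> j \<otimes> inv s" if "j \<in> J" for j
    using conjugate_eq[OF \<open>s \<in> Units R\<close> fc(1) ac(1)] fs sa that by simp
  ultimately show ?thesis
    using inj im unfolding bij_betw_def by blast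
qed


section \<open>Complete dyadic sets of partitions\<close>

lemma orthogonal_finsums:
  assumes "finite J" "finite L" "e \<in> J \<rightarrow> carrier R" "e \<in> L \<rightarrow> carrier R"
    and "\<And>i j. i \<in> J \<Longrightarrow> j \<in> L \<Longrightarrow> e i \<otimes> e j = \<zero>"
  shows "finsum R e J \<otimes> finsum R e L = \<zero>"
proof -
  have "e i \<otimes> finsum R e L = \<zero>" if i: "i \<in> J" for i
  proof -
    have "e i \<in> carrier R"
      using assms(3) i by blast
    then have "e i \<otimes> finsum R e L = (\<Oplus>j\<in>L. e i \<otimes> e j)"
      using assms(2,4) by (simp add: finsum_rdistr)
    also have "\<dots> = (\<Oplus>j\<in>L. \<zero>)"
      using assms(5)[OF i] by (intro finsum_cong') auto
    finally show ?thesis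
      by simp
  qed
  then have "(\<Oplus>i\<in>J. e i \<otimes> finsum R e L) = (\<Oplus>i\<in>J. \<zero>)"
    by (intro finsum_cong') auto
  then show ?thesis
    using assms(1,3,4) by (simp add: finsum_ldistr)
qed

text \<open>Induction runs from the singletons of the last partition back to the first one: at each step only the exceptional
block is new, and it is the node above two blocks that already carry trees.\<close>

lemma peirce_tree_of_dyadic_partitions:
  assumes dec: "one_peirce_decomposition R n e g"
    and dy: "complete_dyadic {1..n} r lam"
    and triv: "\<And>i I J L. i < r \<Longrightarrow> dyadic_split (lam i) (lam (Suc i)) I J L \<Longrightarrow>
      peirce_trivial (corner R (finsum R e I)) (finsum R e J)"
  shows "peirce_tree R (e ` {1..n}) g"
proof -
  have e: "peirce_idempotent 1 R (e j)" "idempotent_of R (e j)" "e j \<in> carrier R" if "j \<in> {1..n}" for j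
    using dec that by (auto simp: one_peirce_decomposition_def peirce_idempotent_def idempotent_of_def)
  have orth: "e i \<otimes> e j = \<zero>" if "i \<in> {1..n}" "j \<in> {1..n}" "i \<noteq> j" for i j
    using dec that by (auto simp: one_peirce_decomposition_def)
  have part: "partition_on {1..n} (lam i)" if "i \<le> r" for i
    using dy that by (simp add: complete_dyadic_def)
  have "\<forall>X\<in>lam 0. peirce_tree R (e ` X) (finsum R e X)"
  proof (rule inc_induct[of 0 r])
    show "\<forall>X\<in>lam r. peirce_tree R (e ` X) (finsum R e X)"
    proof
      fix X assume X: "X \<in> lam r"
      then have "card X = 1"
        using dy by (simp add: complete_dyadic_def)
      then obtain x where x: "X = {x}"
        by (meson card_1_singletonE)
      moreover have "x \<in> {1..n}"
        using partition_onD1[OF part[of r]] X x by auto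
      ultimately show "peirce_tree R (e ` X) (finsum R e X)"
        using peirce_tree.leaf[OF e(1)] e(3) by (simp add: finsum_insert)
    qed
  next
    fix k assume k: "0 \<le> k" "k < r"
      and IH: "\<forall>X\<in>lam (Suc k). peirce_tree R (e ` X) (finsum R e X)"
    obtain I J L where split: "dyadic_split (lam k) (lam (Suc k)) I J L"
      using dy k by (auto simp: complete_dyadic_def dyadic_refinement_def)
    note p = part[of "Suc k"]
    show "\<forall>X\<in>lam k. peirce_tree R (e ` X) (finsum R e X)"
    proof
      fix X assume X: "X \<in> lam k"
      show "peirce_tree R (e ` X) (finsum R e X)"
      proof (cases "X = I")
        case False
        then show ?thesis
          using X split IH by (auto simp: dyadic_split_def)
      next
        case True
        have JL: "J \<in> lam (Suc k)" "L \<in> lam (Suc k)" "J \<noteq> L" "I = J \<union> L"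
          using split by (auto simp: dyadic_split_def)
        have disj: "J \<inter> L = {}"
          using partition_onD2[OF p] JL k by (auto simp: disjoint_def)
        have sub: "J \<subseteq> {1..n}" "L \<subseteq> {1..n}"
          using partition_onD1[OF p] JL k by auto
        have fin: "finite J" "finite L"
          using sub finite_subset by blast+
        have c: "e \<in> J \<rightarrow> carrier R" "e \<in> L \<rightarrow> carrier R"
          using e(3) sub by blast+
        have ne: "i \<noteq> j" if "i \<in> J" "j \<in> L" for i j
          using disj that by blast
        have z: "finsum R e J \<otimes> finsum R e L = \<zero>" "finsum R e L \<otimes> finsum R e J = \<zero>"
          using sub ne orth by (intro orthogonal_finsums fin c; blast)+
        have id: "idempotent_of R (finsum R e J)" "idempotent_of R (finsum R e L)"
          using sub e(2) orth by (intro orthogonal_sum_idempotent fin; blast)+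
        have sum: "finsum R e I = finsum R e J \<oplus> finsum R e L"
          using finsum_Un_disjoint[OF fin disj c] JL(4) by simp
        have "peirce_separated R (finsum R e J) (finsum R e L)"
          using triv[OF k(2) split] peirce_trivial_corner_iff[OF id z] sum by simp
        then have "peirce_tree R (e ` J \<union> e ` L) (finsum R e J \<oplus> finsum R e L)"
          using IH JL z by (intro peirce_tree.node) auto
        then show ?thesis
          using True JL(4) sum by (simp add: image_Un)
      qed
    qed
  qed simp
  then show ?thesis
    using dec dy by (simp add: complete_dyadic_def one_peirce_decomposition_def)
qed

lemma one_peirce_decomposition_inj_on:
  assumes "one_peirce_decomposition R n e g"
  shows "inj_on e {1..n}"
proof (rule inj_onI, rule ccontr)
  fix i j assume ij: "i \<in> {1..n}" "j \<in> {1..n}" "e i = e j" "i \<noteq> j"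
  have i: "peirce_idempotent 1 R (e i)"
    using assms ij(1) by (simp add: one_peirce_decomposition_def)
  have "e i \<otimes> e i = \<zero>"
    using assms ij by (metis one_peirce_decomposition_def)
  then show False
    using i one_peirce_nonzero[OF i] by (simp add: peirce_idempotent_def idempotent_of_def)
qed

end

theorem theorem2p19:
  fixes R :: "('a, 'm) ring_scheme" (structure)
    and n r :: nat
    and e :: "nat \<Rightarrow> 'a"
    and lam :: "nat \<Rightarrow> nat set set"
  assumes "ring R"
    and "peirce_ring n R"
    and "one_peirce_decomposition R n e \<one>"
    and "complete_dyadic {1..n} r lam"
    and "\<And>i I J L. i < r \<Longrightarrow> dyadic_split (lam i) (lam (Suc i)) I J L \<Longrightarrow>
           peirce_trivial (corner R (finsum R e I)) (finsum R e J)"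
  shows
    "(\<forall>m f. m \<le> n \<longrightarrow> one_peirce_decomposition R m f \<one> \<longrightarrow>
        m = n \<and>
        (\<exists>s \<sigma>. s \<in> Units R \<and> \<sigma> permutes {1..n} \<and>
           (\<forall>i\<in>{1..n}. f (\<sigma> i) = s \<otimes> e i \<otimes> inv s))) \<and>
     (\<forall>k f g. peirce_idempotent k R f \<longrightarrow> one_peirce_decomposition R k g f \<longrightarrow>
        (\<exists>\<iota> \<epsilon>.
           (\<forall>j\<in>{1..k}. \<iota> j \<in> {1..n} \<and> peirce_idempotent 1 R (\<epsilon> j) \<and>
              \<epsilon> j \<in> carrier (corner R (e (\<iota> j))) \<and>
              left_module_iso R (left_principal R (g j)) (left_principal R (\<epsilon> j))) \<and>
           (\<forall>i\<in>{1..k}. \<forall>j\<in>{1..k}. i \<noteq> j \<longrightarrow> \<epsilon> i \<otimes> \<epsilon> j = \<zero>) \<and>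
           left_module_iso R (left_principal R f) (left_principal R (finsum R \<epsilon> {1..k})))) \<and>
     (\<forall>f. peirce_trivial R f \<longrightarrow>
        (\<exists>k\<le>n. peirce_idempotent k R f) \<and>
        (\<forall>k g. peirce_idempotent k R f \<longrightarrow> one_peirce_decomposition R k g f \<longrightarrow>
           (\<exists>\<iota> \<epsilon>.
              (\<forall>j\<in>{1..k}. \<iota> j \<in> {1..n} \<and> peirce_idempotent 1 R (\<epsilon> j) \<and>
                 \<epsilon> j \<in> carrier (corner R (e (\<iota> j))) \<and>
                 left_module_iso R (left_principal R (g j)) (left_principal R (\<epsilon> j))) \<and>
              (\<forall>i\<in>{1..k}. \<forall>j\<in>{1..k}. i \<noteq> j \<longrightarrow> \<epsilon> i \<otimes> \<epsilon> j = \<zero>) \<and>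
              left_module_iso R (left_principal R f) (left_principal R (finsum R \<epsilon> {1..k})) \<and>
              (\<forall>j\<in>{1..k}. \<epsilon> j = e (\<iota> j)) \<and>
              inj_on \<iota> {1..k})))"
proof -
  interpret ring R by fact
  define A where "A = e ` {1..n}"
  have t: "peirce_tree R A \<one>"
    unfolding A_def by (rule peirce_tree_of_dyadic_partitions[OF assms(3-5)])
  have inj: "inj_on e {1..n}"
    by (rule one_peirce_decomposition_inj_on[OF assms(3)])
  then have cardA: "card A = n"
    by (simp add: A_def card_image)
  define index where "index = inv_into {1..n} e"
  have index: "index a \<in> {1..n}" "e (index a) = a" if "a \<in> A" for a
    using that by (auto simp: index_def A_def inv_into_into f_inv_into_f simp del: atLeastAtMost_iff)
  have iso: "left_module_iso R (left_principal R x) (left_principal R y)"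
    if "\<exists>s\<in>Units R. x \<otimes> s = s \<otimes> y" "x \<in> carrier R" "y \<in> carrier R" for x y
    using that conjugate_left_module_iso by blast

  have conjugate: "m = n \<and> (\<exists>s \<sigma>. s \<in> Units R \<and> \<sigma> permutes {1..n} \<and>
      (\<forall>i\<in>{1..n}. f (\<sigma> i) = s \<otimes> e i \<otimes> inv s))"
    if m: "m \<le> n" and f: "one_peirce_decomposition R m f \<one>" for m f
  proof -
    obtain s \<alpha> where s: "s \<in> Units R" and \<alpha>: "bij_betw \<alpha> {1..m} A"
      and conj: "\<And>j. j \<in> {1..m} \<Longrightarrow> f j = s \<otimes> \<alpha> j \<otimes> inv s"
      using one_peirce_decomposition_conjugate[OF t, of "{1..m}" f] m f cardA
      by (auto simp: one_peirce_decomposition_def)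
    have mn: "m = n"
      using bij_betw_same_card[OF \<alpha>] cardA by simp
    define \<sigma> where "\<sigma> i = (if i \<in> {1..n} then inv_into {1..n} \<alpha> (e i) else i)" for i
    have \<alpha>': "bij_betw \<alpha> {1..n} A"
      using \<alpha> mn by simp
    have "bij_betw (inv_into {1..n} \<alpha> \<circ> e) {1..n} {1..n}"
      using bij_betw_trans[OF _ bij_betw_inv_into[OF \<alpha>']] inj by (auto simp: A_def bij_betw_def)
    then have "bij_betw \<sigma> {1..n} {1..n}"
      by (rule bij_betw_cong[THEN iffD1, rotated]) (simp add: \<sigma>_def)
    then have "\<sigma> permutes {1..n}"
      by (rule bij_imp_permutes) (simp add: \<sigma>_def del: atLeastAtMost_iff)
    moreover have "f (\<sigma> i) = s \<otimes> e i \<otimes> inv s" if i: "i \<in> {1..n}" for i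
    proof -
      have "e i \<in> \<alpha> ` {1..n}"
        using \<alpha>' i by (auto simp: bij_betw_def A_def)
      then have "\<sigma> i \<in> {1..n}" "\<alpha> (\<sigma> i) = e i"
        using i inv_into_into[of "e i" \<alpha> "{1..n}"] f_inv_into_f[of "e i" \<alpha> "{1..n}"]
        by (simp_all add: \<sigma>_def)
      then show ?thesis
        using conj[of "\<sigma> i"] mn by simp
    qed
    ultimately show ?thesis
      using mn s by blast
  qed

  have components: "\<exists>\<alpha> \<epsilon>. (\<forall>j\<in>{1..k}. \<alpha> j \<in> A \<and> peirce_idempotent 1 R (\<epsilon> j) \<and>
        \<epsilon> j \<in> carrier (corner R (\<alpha> j)) \<and>
        left_module_iso R (left_principal R (g j)) (left_principal R (\<epsilon> j))) \<and>
      (\<forall>i\<in>{1..k}. \<forall>j\<in>{1..k}. i \<noteq> j \<longrightarrow> \<epsilon> i \<otimes> \<epsilon> j = \<zero>) \<and>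
      left_module_iso R (left_principal R f) (left_principal R (finsum R \<epsilon> {1..k})) \<and>
      (\<forall>a\<in>A. a \<otimes> f \<otimes> a \<noteq> \<zero> \<longrightarrow> a \<in> \<alpha> ` {1..k}) \<and>
      (inj_on \<alpha> {1..k} \<longrightarrow> (\<forall>j\<in>{1..k}. \<alpha> j \<otimes> f \<otimes> \<alpha> j = \<epsilon> j))"
    if g: "one_peirce_decomposition R k g f" for k f g
  proof -
    have g1: "peirce_idempotent 1 R (g j)" "g j \<in> carrier R" if "j \<in> {1..k}" for j
      using g that by (auto simp: one_peirce_decomposition_def peirce_idempotent_def idempotent_of_def)
    have g0: "g i \<otimes> g j = \<zero>" if "i \<in> {1..k}" "j \<in> {1..k}" "i \<noteq> j" for i j
      using g that by (simp add: one_peirce_decomposition_def)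
    have sum: "finsum R g {1..k} = f"
      using g by (simp add: one_peirce_decomposition_def)
    obtain \<alpha> \<epsilon> where \<alpha>: "\<And>j. j \<in> {1..k} \<Longrightarrow> \<alpha> j \<in> A"
      and \<epsilon>: "\<And>j. j \<in> {1..k} \<Longrightarrow> \<epsilon> j \<in> carrier (corner R (\<alpha> j))"
        "\<And>j. j \<in> {1..k} \<Longrightarrow> peirce_idempotent 1 R (\<epsilon> j)"
        "\<And>j. j \<in> {1..k} \<Longrightarrow> \<exists>s\<in>Units R. g j \<otimes> s = s \<otimes> \<epsilon> j"
        "\<And>i j. i \<in> {1..k} \<Longrightarrow> j \<in> {1..k} \<Longrightarrow> i \<noteq> j \<Longrightarrow> \<epsilon> i \<otimes> \<epsilon> j = \<zero>"
        "\<exists>s\<in>Units R. finsum R g {1..k} \<otimes> s = s \<otimes> finsum R \<epsilon> {1..k}"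
      and surj: "\<And>a. a \<in> A \<Longrightarrow> a \<otimes> finsum R g {1..k} \<otimes> a \<noteq> \<zero> \<Longrightarrow> a \<in> \<alpha> ` {1..k}"
      and single: "\<And>j. inj_on \<alpha> {1..k} \<Longrightarrow> j \<in> {1..k} \<Longrightarrow> \<alpha> j \<otimes> finsum R g {1..k} \<otimes> \<alpha> j = \<epsilon> j"
      by (rule one_peirce_family_components[OF t finite_atLeastAtMost g1(1) g0]) (assumption | blast)+
    have c: "\<epsilon> j \<in> carrier R" if "j \<in> {1..k}" for j
      using \<epsilon>(2)[OF that] by (simp add: peirce_idempotent_def idempotent_of_def)
    have iso_g: "left_module_iso R (left_principal R (g j)) (left_principal R (\<epsilon> j))" if "j \<in> {1..k}" for j
      by (rule iso[OF \<epsilon>(3) g1(2) c]) (rule that)+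
    have iso_f: "left_module_iso R (left_principal R f) (left_principal R (finsum R \<epsilon> {1..k}))"
      unfolding sum[symmetric] by (rule iso[OF \<epsilon>(5)]) (use g1(2) c in \<open>auto simp del: atLeastAtMost_iff\<close>)
    show ?thesis
      by (rule exI[of _ \<alpha>], rule exI[of _ \<epsilon>], intro conjI ballI impI)
         (fact \<alpha> \<epsilon>(1,2,4) iso_g iso_f surj[unfolded sum] single[unfolded sum])+
  qed

  have general: "\<exists>\<iota> \<epsilon>. (\<forall>j\<in>{1..k}. \<iota> j \<in> {1..n} \<and> peirce_idempotent 1 R (\<epsilon> j) \<and>
        \<epsilon> j \<in> carrier (corner R (e (\<iota> j))) \<and>
        left_module_iso R (left_principal R (g j)) (left_principal R (\<epsilon> j))) \<and>
      (\<forall>i\<in>{1..k}. \<forall>j\<in>{1..k}. i \<noteq> j \<longrightarrow> \<epsilon> i \<otimes> \<epsilon> j = \<zero>) \<and>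
      left_module_iso R (left_principal R f) (left_principal R (finsum R \<epsilon> {1..k}))"
    if g: "one_peirce_decomposition R k g f" for k f g
  proof -
    obtain \<alpha> \<epsilon> where \<alpha>: "\<forall>j\<in>{1..k}. \<alpha> j \<in> A \<and> peirce_idempotent 1 R (\<epsilon> j) \<and>
        \<epsilon> j \<in> carrier (corner R (\<alpha> j)) \<and>
        left_module_iso R (left_principal R (g j)) (left_principal R (\<epsilon> j))"
      and rest: "\<forall>i\<in>{1..k}. \<forall>j\<in>{1..k}. i \<noteq> j \<longrightarrow> \<epsilon> i \<otimes> \<epsilon> j = \<zero>"
        "left_module_iso R (left_principal R f) (left_principal R (finsum R \<epsilon> {1..k}))"
      using components[OF g] by blast
    have "\<forall>j\<in>{1..k}. (index \<circ> \<alpha>) j \<in> {1..n} \<and> peirce_idempotent 1 R (\<epsilon> j) \<and>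
        \<epsilon> j \<in> carrier (corner R (e ((index \<circ> \<alpha>) j))) \<and>
        left_module_iso R (left_principal R (g j)) (left_principal R (\<epsilon> j))"
      using \<alpha> index by (simp del: atLeastAtMost_iff)
    then show ?thesis
      using rest by blast
  qed

  have trivial: "(\<exists>k\<le>n. peirce_idempotent k R f) \<and>
      (\<forall>k g. peirce_idempotent k R f \<longrightarrow> one_peirce_decomposition R k g f \<longrightarrow>
        (\<exists>\<iota> \<epsilon>.
           (\<forall>j\<in>{1..k}. \<iota> j \<in> {1..n} \<and> peirce_idempotent 1 R (\<epsilon> j) \<and>
              \<epsilon> j \<in> carrier (corner R (e (\<iota> j))) \<and>
              left_module_iso R (left_principal R (g j)) (left_principal R (\<epsilon> j))) \<and>
           (\<forall>i\<in>{1..k}. \<forall>j\<in>{1..k}. i \<noteq> j \<longrightarrow> \<epsilon> i \<otimes> \<epsilon> j = \<zero>) \<and>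
           left_module_iso R (left_principal R f) (left_principal R (finsum R \<epsilon> {1..k})) \<and>
           (\<forall>j\<in>{1..k}. \<epsilon> j = e (\<iota> j)) \<and>
           inj_on \<iota> {1..k}))" if f: "peirce_trivial R f" for f
  proof -
    define K where "K = {a \<in> A. a \<otimes> f \<otimes> a = a}"
    have K: "K \<subseteq> A"
      by (auto simp: K_def)
    have finA: "finite A"
      by (rule peirce_tree_facts(1)[OF t])
    have fK: "peirce_idempotent (card K) R f"
      unfolding K_def by (rule peirce_trivial_imp_peirce_idempotent[OF t f])
    have "card K \<le> n"
      using card_mono[OF finA K] cardA by simp
    moreover have "\<exists>\<iota> \<epsilon>.
           (\<forall>j\<in>{1..k}. \<iota> j \<in> {1..n} \<and> peirce_idempotent 1 R (\<epsilon> j) \<and>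
              \<epsilon> j \<in> carrier (corner R (e (\<iota> j))) \<and>
              left_module_iso R (left_principal R (g j)) (left_principal R (\<epsilon> j))) \<and>
           (\<forall>i\<in>{1..k}. \<forall>j\<in>{1..k}. i \<noteq> j \<longrightarrow> \<epsilon> i \<otimes> \<epsilon> j = \<zero>) \<and>
           left_module_iso R (left_principal R f) (left_principal R (finsum R \<epsilon> {1..k})) \<and>
           (\<forall>j\<in>{1..k}. \<epsilon> j = e (\<iota> j)) \<and>
           inj_on \<iota> {1..k}"
      if k: "peirce_idempotent k R f" and g: "one_peirce_decomposition R k g f" for k g
    proof -
      obtain \<alpha> \<epsilon> where \<alpha>: "\<forall>j\<in>{1..k}. \<alpha> j \<in> A \<and> peirce_idempotent 1 R (\<epsilon> j) \<and>
          \<epsilon> j \<in> carrier (corner R (\<alpha> j)) \<and>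
          left_module_iso R (left_principal R (g j)) (left_principal R (\<epsilon> j))"
        and rest: "\<forall>i\<in>{1..k}. \<forall>j\<in>{1..k}. i \<noteq> j \<longrightarrow> \<epsilon> i \<otimes> \<epsilon> j = \<zero>"
          "left_module_iso R (left_principal R f) (left_principal R (finsum R \<epsilon> {1..k}))"
        and surj: "\<forall>a\<in>A. a \<otimes> f \<otimes> a \<noteq> \<zero> \<longrightarrow> a \<in> \<alpha> ` {1..k}"
        and single: "inj_on \<alpha> {1..k} \<longrightarrow> (\<forall>j\<in>{1..k}. \<alpha> j \<otimes> f \<otimes> \<alpha> j = \<epsilon> j)"
        using components[OF g] by blast
      \<comment> \<open>The number of leaves below \<open>f\<close> is intrinsic. Knowing \<open>k\<close> turns the inclusion below into an equality, so that no
        leaf is hit twice.\<close>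
      have kK: "k = card K"
        using k fK by (auto simp: peirce_idempotent_def intro: peirce_ring_unique)
      have "K \<subseteq> \<alpha> ` {1..k}"
      proof
        fix a assume "a \<in> K"
        then have a: "a \<in> A" "a \<otimes> f \<otimes> a = a"
          by (simp_all add: K_def)
        then show "a \<in> \<alpha> ` {1..k}"
          using surj one_peirce_nonzero[OF peirce_tree_facts(5)[OF t a(1)]] by simp
      qed
      moreover have "card (\<alpha> ` {1..k}) \<le> card K"
        using card_image_le[of "{1..k}" \<alpha>] kK by simp
      ultimately have im: "K = \<alpha> ` {1..k}"
        by (intro card_seteq) simp_all
      then have inj\<alpha>: "inj_on \<alpha> {1..k}"
        using kK by (intro eq_card_imp_inj_on) simp_all
      have \<epsilon>: "\<epsilon> j = \<alpha> j" if "j \<in> {1..k}" for j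
      proof -
        have "\<alpha> j \<in> K"
          unfolding im using that by (rule imageI)
        then show ?thesis
          using single inj\<alpha> that by (simp add: K_def del: atLeastAtMost_iff)
      qed
      have eq: "e ((index \<circ> \<alpha>) j) = \<alpha> j" if "j \<in> {1..k}" for j
        using \<alpha> index that by (simp del: atLeastAtMost_iff)
      have 1: "\<forall>j\<in>{1..k}. (index \<circ> \<alpha>) j \<in> {1..n} \<and> peirce_idempotent 1 R (\<epsilon> j) \<and>
          \<epsilon> j \<in> carrier (corner R (e ((index \<circ> \<alpha>) j))) \<and>
          left_module_iso R (left_principal R (g j)) (left_principal R (\<epsilon> j))"
        using \<alpha> index by (simp del: atLeastAtMost_iff)
      have 2: "\<forall>j\<in>{1..k}. \<epsilon> j = e ((index \<circ> \<alpha>) j)"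
        using \<epsilon> eq by simp
      have 3: "inj_on (index \<circ> \<alpha>) {1..k}"
        using inj\<alpha> eq by (metis (no_types, lifting) inj_on_def)
      show ?thesis
        using 1 rest 2 3 by blast
    qed
    ultimately show ?thesis
      using fK by blast
  qed

  show ?thesis
    by (rule conjI, (intro allI impI, rule conjugate, assumption+), rule conjI,
        (intro allI impI, rule general, assumption), intro allI impI, rule trivial, assumption)
qed

end
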